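(* For every positive integer $n$ with $n\equiv 50 \pmod{288}$, there exists a simple planar graph $G$ on $n$ vertices containing neither $K_4$ nor $C_6$ as a subgraph such that $e(G)=\frac{7}{3}(n-2)$.
   Context: $K_4$ is the complete graph on $4$ vertices, $C_6$ the cycle on $6$ vertices; $e(G)$ is the number of edges of $G$. *)

theory Defs
  imports "HOL-Analysis.Analysis"
begin

definition simple_graph :: "'a set \<Rightarrow> 'a set set \<Rightarrow> bool" where
  "simple_graph V E \<longleftrightarrow> finite V \<and>
     (\<forall>e\<in>E. \<exists>u v. u \<in> V \<and> v \<in> V \<and> u \<noteq> v \<and> e = {u, v})"

definition planar :: "'a set \<Rightarrow> 'a set set \<Rightarrow> bool" where
  "planar V E \<longleftrightarrow> (\<exists>(p :: 'a \<Rightarrow> complex) (\<gamma> :: 'a set \<Rightarrow> real \<Rightarrow> complex).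
     inj_on p V \<and>
     (\<forall>e\<in>E. \<exists>u v. e = {u, v} \<and> arc (\<gamma> e) \<and> pathstart (\<gamma> e) = p u \<and> pathfinish (\<gamma> e) = p v) \<and>
     (\<forall>e\<in>E. \<forall>w\<in>V. p w \<in> path_image (\<gamma> e) \<longrightarrow> w \<in> e) \<and>
     (\<forall>e\<in>E. \<forall>f\<in>E. e \<noteq> f \<longrightarrow> path_image (\<gamma> e) \<inter> path_image (\<gamma> f) \<subseteq> p ` (e \<inter> f)))"

definition contains_K4 :: "'a set \<Rightarrow> 'a set set \<Rightarrow> bool" where
  "contains_K4 V E \<longleftrightarrow> (\<exists>a b c d. a \<in> V \<and> b \<in> V \<and> c \<in> V \<and> d \<in> V \<and>
     distinct [a, b, c, d] \<and>
     {a, b} \<in> E \<and> {a, c} \<in> E \<and> {a, d} \<in> E \<and> {b, c} \<in> E \<and> {b, d} \<in> E \<and> {c, d} \<in> E)"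

definition contains_C6 :: "'a set \<Rightarrow> 'a set set \<Rightarrow> bool" where
  "contains_C6 V E \<longleftrightarrow> (\<exists>v :: nat \<Rightarrow> 'a. (\<forall>i<6. v i \<in> V) \<and> inj_on v {..<6} \<and>
     (\<forall>i<6. {v i, v ((i + 1) mod 6)} \<in> E))"

end

theory Submission
  imports Defs
begin

text \<open>
  The graph is a union of wheels with four spokes that share only rim vertices, drawn so that every
  face outside the wheels has length 7. If there are \<open>q\<close> wheels, then \<open>e = 8 q\<close> and
  \<open>f = 4 q + 4 q / 7\<close>, so Euler's formula gives \<open>n - 2 = 24 q / 7\<close> and hence \<open>e = 7 (n - 2) / 3\<close>.
  A wheel contains neither \<open>K\<^sub>4\<close> nor \<open>C\<^sub>6\<close>, and every cycle through several wheels has length at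
  least 7.

  The wheels are arranged in rings on a cylinder: a bottom ring, \<open>J\<close> copies of a block of 21 wheels
  and a top cap, with \<open>n = 50 + 72 J\<close>. A hexagon meets at most two consecutive layers, so its absence
  follows from that in the graphs with \<open>J = 0\<close> and \<open>J = 2\<close>. For planarity the wheels are given integer
  coordinates for which any two are separated by a horizontal or vertical line, which they touch in
  at most one vertex each; the exponential function maps the cylinder into the plane.
\<close>

section \<open>Transport along injections\<close>

text \<open>Used, like its companion for hexagons, in two ways: to rename vertices to natural
  numbers, and to shift a small subgraph vertically into a graph checked by evaluation.\<close>

lemma contains_K4_map:
  assumes "contains_K4 V E" "inj_on h V" "h ` V \<subseteq> W" "\<And>e. e \<in> E \<Longrightarrow> h ` e \<in> F"
  shows "contains_K4 W F"
proof -
  obtain a b c d where v: "a \<in> V" "b \<in> V" "c \<in> V" "d \<in> V" and dist: "distinct [a, b, c, d]"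
    and e: "{a, b} \<in> E" "{a, c} \<in> E" "{a, d} \<in> E" "{b, c} \<in> E" "{b, d} \<in> E" "{c, d} \<in> E"
    using assms(1) unfolding contains_K4_def by blast
  have "distinct (map h [a, b, c, d])"
    using dist v assms(2) by (auto dest: inj_onD)
  moreover have "{h a, h b} \<in> F" "{h a, h c} \<in> F" "{h a, h d} \<in> F" "{h b, h c} \<in> F"
    "{h b, h d} \<in> F" "{h c, h d} \<in> F"
    using e[THEN assms(4)] by simp_all
  ultimately show ?thesis
    using v assms(3) unfolding contains_K4_def
    by (intro exI[of _ "h a"] exI[of _ "h b"] exI[of _ "h c"] exI[of _ "h d"]) auto
qed

lemma contains_C6_map:
  assumes "contains_C6 V E" "inj_on h V" "h ` V \<subseteq> W" "\<And>e. e \<in> E \<Longrightarrow> h ` e \<in> F"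
  shows "contains_C6 W F"
proof -
  obtain v :: "nat \<Rightarrow> 'a" where v: "\<forall>i<6. v i \<in> V" "inj_on v {..<6}"
      "\<forall>i<6. {v i, v ((i + 1) mod 6)} \<in> E"
    using assms(1) unfolding contains_C6_def by blast
  have "inj_on (h \<circ> v) {..<6}"
    using v(1,2) assms(2) by (intro comp_inj_on) (auto intro: inj_on_subset)
  moreover have "{h (v i), h (v ((i + 1) mod 6))} \<in> F" if "i < 6" for i
    using assms(4)[of "{v i, v ((i + 1) mod 6)}"] v(3) that by simp
  ultimately show ?thesis
    using v(1) assms(3) unfolding contains_C6_def by (intro exI[of _ "h \<circ> v"]) auto
qed

text \<open>The drawing is pulled back: each edge gets the arc of its image. Injectivity of
  \<open>h\<close> on \<open>W\<close> makes images respect equality and intersection of edges, so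
  incidences and crossings correspond.\<close>

lemma planar_map:
  fixes V :: "'a set" and W :: "'b set"
  assumes pl: "planar V E" and inj: "inj_on h W" and V: "h ` W \<subseteq> V"
    and F: "\<And>e. e \<in> F \<Longrightarrow> h ` e \<in> E" and W: "\<And>e. e \<in> F \<Longrightarrow> e \<subseteq> W"
  shows "planar W F"
proof -
  obtain p :: "'a \<Rightarrow> complex" and \<gamma> where p: "inj_on p V"
    and arc: "\<forall>e\<in>E. \<exists>u v. e = {u, v} \<and> arc (\<gamma> e) \<and> pathstart (\<gamma> e) = p u \<and> pathfinish (\<gamma> e) = p v"
    and vert: "\<forall>e\<in>E. \<forall>w\<in>V. p w \<in> path_image (\<gamma> e) \<longrightarrow> w \<in> e"
    and cr: "\<forall>e\<in>E. \<forall>f\<in>E. e \<noteq> f \<longrightarrow> path_image (\<gamma> e) \<inter> path_image (\<gamma> f) \<subseteq> p ` (e \<inter> f)"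
    using pl unfolding planar_def by (elim exE conjE) (rule that)
  define p' and \<gamma>' where "p' = p \<circ> h" and "\<gamma>' = (\<lambda>e. \<gamma> (h ` e))"
  have 1: "inj_on p' W"
    unfolding p'_def using inj p V by (meson comp_inj_on inj_on_subset)
  have 2: "\<exists>u v. e = {u, v} \<and> arc (\<gamma>' e) \<and> pathstart (\<gamma>' e) = p' u \<and> pathfinish (\<gamma>' e) = p' v"
    if e: "e \<in> F" for e
  proof -
    obtain u v where uv: "h ` e = {u, v}" "arc (\<gamma>' e)" "pathstart (\<gamma>' e) = p u" "pathfinish (\<gamma>' e) = p v"
      using arc F[OF e] unfolding \<gamma>'_def by blast
    have "u \<in> h ` e" "v \<in> h ` e"
      using uv(1) by auto
    then obtain a b where ab: "a \<in> e" "b \<in> e" "h a = u" "h b = v"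
      by blast
    have "h ` e = h ` {a, b}"
      using uv(1) ab by simp
    then have "e = {a, b}"
      using inj_on_image_eq_iff[OF inj W[OF e], of "{a, b}"] W[OF e] ab by auto
    then show ?thesis
      using uv ab unfolding p'_def by auto
  qed
  have 3: "w \<in> e" if "e \<in> F" "w \<in> W" "p' w \<in> path_image (\<gamma>' e)" for e w
  proof -
    have "h w \<in> h ` e"
      using vert[rule_format, OF F[OF that(1)], of "h w"] V that(2,3) unfolding p'_def \<gamma>'_def by auto
    then show ?thesis
      using inj_on_image_mem_iff[OF inj that(2) W[OF that(1)]] by simp
  qed
  have 4: "path_image (\<gamma>' e) \<inter> path_image (\<gamma>' f) \<subseteq> p' ` (e \<inter> f)"
    if "e \<in> F" "f \<in> F" "e \<noteq> f" for e f
  proof -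
    have "h ` e \<noteq> h ` f"
      using inj_on_image_eq_iff[OF inj W[OF that(1)] W[OF that(2)]] that(3) by simp
    moreover have "h ` (e \<inter> f) = h ` e \<inter> h ` f"
      using inj_on_image_Int[OF inj W[OF that(1)] W[OF that(2)]] .
    ultimately show ?thesis
      using cr[rule_format, OF F[OF that(1)] F[OF that(2)]]
      unfolding p'_def \<gamma>'_def image_comp[symmetric] by simp
  qed
  show ?thesis
    unfolding planar_def
  proof (intro exI[of _ p'] exI[of _ \<gamma>'] conjI ballI impI)
    show "inj_on p' W"
      by (rule 1)
  qed (fact 2, fact 3, fact 4)
qed

text \<open>The edges are carried over by a bijection \<open>g\<close>; planarity and the absence of
  subgraphs are inherited along its inverse \<open>h\<close>, which maps the new graph into the old
  one.\<close>

lemma graph_on_initial_segment: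
  fixes V :: "'a set"
  assumes V: "card V = n" and sg: "simple_graph V E" and "planar V E"
    and "\<not> contains_K4 V E" and "\<not> contains_C6 V E"
  shows "\<exists>F :: nat set set. simple_graph {..<n} F \<and> planar {..<n} F \<and>
    \<not> contains_K4 {..<n} F \<and> \<not> contains_C6 {..<n} F \<and> card F = card E"
proof -
  have "finite V"
    using sg unfolding simple_graph_def by blast
  then obtain g where g: "bij_betw g V {..<n}"
    using ex_bij_betw_finite_nat[of V] V by (auto simp: atLeast0LessThan)
  define h where "h = inv_into V g"
  have h: "bij_betw h {..<n} V"
    unfolding h_def using g by (rule bij_betw_inv_into)
  have EV: "e \<subseteq> V" if "e \<in> E" for e
    using sg that unfolding simple_graph_def by auto
  have hg: "h ` g ` e = e" if "e \<in> E" for e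
    using EV[OF that] g unfolding h_def bij_betw_def by (simp add: inv_into_image_cancel)
  define F where "F = (`) g ` E"
  have F: "h ` e \<in> E" "e \<subseteq> {..<n}" if eF: "e \<in> F" for e
  proof -
    obtain e0 where e0: "e0 \<in> E" "e = g ` e0"
      using eF unfolding F_def by blast
    show "h ` e \<in> E"
      using e0 hg by simp
    show "e \<subseteq> {..<n}"
      using e0(2) image_mono[OF EV[OF e0(1)], of g] g unfolding bij_betw_def by simp
  qed
  have "inj_on ((`) g) E"
    by (rule inj_on_inverseI[of _ "(`) h"]) (rule hg)
  then have "card F = card E"
    unfolding F_def by (rule card_image)
  moreover have "simple_graph {..<n} F"
    unfolding simple_graph_def
  proof (intro conjI ballI)
    fix e assume "e \<in> F"
    then obtain u v where "u \<in> V" "v \<in> V" "u \<noteq> v" "e = {g u, g v}"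
      using sg unfolding F_def simple_graph_def by fastforce
    moreover from this have "g u \<in> {..<n}" "g v \<in> {..<n}" "g u \<noteq> g v"
      using g by (auto dest: bij_betwE bij_betw_imp_inj_on inj_onD)
    ultimately show "\<exists>u v. u \<in> {..<n} \<and> v \<in> {..<n} \<and> u \<noteq> v \<and> e = {u, v}"
      by blast
  qed simp
  moreover have inj: "inj_on h {..<n}" and im: "h ` {..<n} \<subseteq> V"
    using h unfolding bij_betw_def by auto
  moreover have "planar {..<n} F"
    using planar_map[OF assms(3) inj im F] .
  ultimately show ?thesis
    using contains_K4_map[OF _ inj im F(1)] contains_C6_map[OF _ inj im F(1)] assms(4,5) by blast
qed

section \<open>Drawing on a cylinder\<close>

text \<open>A \<open>point\<close> lives in the universal cover of a cylinder of circumference 32; \<open>cyl\<close> wraps the cover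
  onto the punctured plane, and \<open>node\<close> is the canonical representative modulo the circumference.\<close>

type_synonym point = "int \<times> int"

definition pos :: "point \<Rightarrow> complex" where
  "pos p = Complex (of_int (fst p)) (of_int (snd p))"

definition cyl :: "complex \<Rightarrow> complex" where
  "cyl z = exp (Complex (Im z) (pi / 16 * Re z))"

definition turn :: "int \<Rightarrow> point \<Rightarrow> point" where
  "turn k p = (fst p + 32 * k, snd p)"

definition node :: "point \<Rightarrow> point" where
  "node p = (fst p mod 32, snd p)"

lemma inj_pos: "pos p = pos q \<Longrightarrow> p = q"
  by (simp add: pos_def prod_eq_iff)

lemma pos_turn: "pos (turn k p) = pos p + of_int (32 * k)"
  by (simp add: pos_def turn_def complex_eq_iff)

lemma node_turn: "node (turn k p) = node p"
  by (simp add: node_def turn_def)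

lemma node_eqD:
  assumes "node p = node q"
  shows "\<exists>k. p = turn k q"
proof -
  have "fst p mod 32 = fst q mod 32" "snd p = snd q"
    using assms unfolding node_def by simp_all
  moreover from this obtain k where "fst p - fst q = 32 * k"
    unfolding mod_eq_dvd_iff by (elim dvdE)
  ultimately have "p = turn k q"
    unfolding turn_def prod_eq_iff by simp
  then show ?thesis ..
qed

text \<open>The factor \<open>pi / 16\<close> turns the period of \<open>exp\<close> into the
  horizontal period 32.\<close>

lemma cyl_eqD:
  assumes "cyl z = cyl w"
  shows "\<exists>k::int. z = w + of_int (32 * k)"
proof -
  obtain k :: int where "Complex (Im z) (pi / 16 * Re z) =
      Complex (Im w) (pi / 16 * Re w) + of_int (2 * k) * pi * \<i>"
    using assms unfolding cyl_def exp_eq by blast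
  then have "Im z = Im w" "pi / 16 * Re z = pi / 16 * (Re w + 32 * k)"
    by (simp_all add: complex_eq_iff algebra_simps)
  then have "z = w + of_int (32 * k)"
    by (simp add: complex_eq_iff)
  then show ?thesis ..
qed

lemma cyl_turn: "cyl (z + of_int (32 * k)) = cyl z"
  unfolding cyl_def exp_eq by (rule exI[of _ k]) (simp add: complex_eq_iff algebra_simps)

lemma cyl_pos_node: "cyl (pos (node p)) = cyl (pos p)"
proof -
  obtain k where "p = turn k (node p)"
    using node_eqD[of p "node p"] unfolding node_def by auto
  then show ?thesis
    using cyl_turn by (metis pos_turn)
qed

lemma cyl_pos_eq_iff: "cyl (pos p) = cyl (pos q) \<longleftrightarrow> node p = node q"
proof
  assume "cyl (pos p) = cyl (pos q)"
  then obtain k where "pos p = pos (turn k q)"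
    using cyl_eqD pos_turn by metis
  then show "node p = node q"
    using inj_pos node_turn by metis
next
  assume "node p = node q"
  then show "cyl (pos p) = cyl (pos q)"
    using cyl_pos_node by metis
qed

lemma continuous_on_cyl: "continuous_on A cyl"
  unfolding cyl_def Complex_eq by (intro continuous_intros)

section \<open>Separating segments in the cover by affine functions\<close>

lemma closed_segment_extreme:
  fixes F :: "'a::real_vector \<Rightarrow> real"
  assumes F: "\<And>u. F ((1 - u) *\<^sub>R a + u *\<^sub>R b) = (1 - u) * F a + u * F b"
    and z: "z \<in> closed_segment a b" and le: "F a \<le> m" "F b \<le> m"
  shows "F z \<le> m" and "F z = m \<Longrightarrow> \<not> (F a = m \<and> F b = m) \<Longrightarrow> z = a \<or> z = b"
proof -
  obtain u where u: "0 \<le> u" "u \<le> 1" "z = (1 - u) *\<^sub>R a + u *\<^sub>R b"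
    using z unfolding in_segment by blast
  \<comment> \<open>Both claims follow from this: a weighted sum of two nonnegative terms is
    nonnegative, and it vanishes only if both terms do.\<close>
  have eq: "m - F z = (1 - u) * (m - F a) + u * (m - F b)"
    unfolding u(3) F by (simp add: algebra_simps)
  have nn: "0 \<le> (1 - u) * (m - F a)" "0 \<le> u * (m - F b)"
    using u le by simp_all
  show "F z \<le> m"
    using eq nn by linarith
  assume "F z = m" "\<not> (F a = m \<and> F b = m)"
  then have "(1 - u) * (m - F a) = 0" "u * (m - F b) = 0"
    using eq nn by linarith+
  then have "u = 0 \<or> u = 1"
    using \<open>\<not> (F a = m \<and> F b = m)\<close> by auto
  then show "z = a \<or> z = b"
    using u(3) by auto
qed

text \<open>Extremal points are required to be unique when the two sides touch, so that convex hulls on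
  either side can only share a common vertex.\<close>

definition below :: "(point \<Rightarrow> int) \<Rightarrow> point list \<Rightarrow> point list \<Rightarrow> bool" where
  "below f q r \<longleftrightarrow> (let m = Max (f ` set q) in
     (\<forall>v\<in>set r. m < f v) \<or>
     (\<forall>v\<in>set r. m \<le> f v) \<and>
     length (filter (\<lambda>u. f u = m) q) \<le> 1 \<and> length (filter (\<lambda>v. f v = m) r) \<le> 1)"

definition apart :: "point list \<Rightarrow> point list \<Rightarrow> bool" where
  "apart q r \<longleftrightarrow> below fst q r \<or> below fst r q \<or> below snd q r \<or> below snd r q"

text \<open>Twice the signed area of the triangle \<open>a\<close>, \<open>b\<close>,
  \<open>c\<close>; the sign tells on which side of the line through \<open>a\<close> and
  \<open>b\<close> the point \<open>c\<close> lies.\<close>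

definition cross :: "point \<Rightarrow> point \<Rightarrow> point \<Rightarrow> int" where
  "cross a b c = (fst b - fst a) * (snd c - snd a) - (snd b - snd a) * (fst c - fst a)"

text \<open>Sufficient conditions that can be evaluated: one segment lies strictly on one side of
  the line through the other, or they share an endpoint without being collinear, or they are
  separated in the sense of \<open>apart\<close>.\<close>

fun noncrossing :: "point \<times> point \<Rightarrow> point \<times> point \<Rightarrow> bool" where
  "noncrossing (a, b) (c, d) \<longleftrightarrow>
     cross a b c * cross a b d > 0 \<or> cross c d a * cross c d b > 0 \<or>
     (a = c \<or> a = d \<or> b = c \<or> b = d) \<and> (cross a b c \<noteq> 0 \<or> cross a b d \<noteq> 0) \<or>
     apart [a, b] [c, d]"

lemma filter_length_le_1D:
  assumes "length (filter P xs) \<le> 1" "a \<in> set xs" "b \<in> set xs" "P a" "P b"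
  shows "a = b"
proof -
  have "a \<in> set (filter P xs)" "b \<in> set (filter P xs)"
    using assms by auto
  with assms(1) show ?thesis
    by (cases "filter P xs") auto
qed

text \<open>\<open>F\<close> extends the integer coordinate \<open>f\<close> to the plane. At a
  common point \<open>F\<close> equals the maximum \<open>m\<close> over \<open>q\<close>, and
  uniqueness of the extremal points makes it an endpoint of both segments.\<close>

lemma below_segments:
  assumes "below f q r"
    and lin: "\<And>u x y. F ((1 - u) *\<^sub>R x + u *\<^sub>R y) = (1 - u) * F x + u * F y"
    and F: "\<And>p. F (pos p) = of_int (f p)"
    and ab: "a \<in> set q" "b \<in> set q" "a \<noteq> b" and cd: "c \<in> set r" "d \<in> set r" "c \<noteq> d"
    and z: "z \<in> closed_segment (pos a) (pos b)" "z \<in> closed_segment (pos c) (pos d)"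
  shows "z \<in> {pos a, pos b} \<inter> {pos c, pos d}"
proof -
  define m where "m = Max (f ` set q)"
  have le: "f a \<le> m" "f b \<le> m"
    unfolding m_def using ab by simp_all
  then have zm: "F z \<le> m"
    by (intro closed_segment_extreme(1)[OF lin z(1)]) (simp_all add: F)
  have lin': "- F ((1 - u) *\<^sub>R x + u *\<^sub>R y) = (1 - u) * - F x + u * - F y" for u x y
    unfolding lin by simp
  have bel: "(\<forall>v\<in>set r. m < f v) \<or> (\<forall>v\<in>set r. m \<le> f v) \<and>
     length (filter (\<lambda>u. f u = m) q) \<le> 1 \<and> length (filter (\<lambda>v. f v = m) r) \<le> 1"
    using assms(1) unfolding below_def m_def Let_def .
  have "\<not> (\<forall>v\<in>set r. m < f v)"
  proof
    assume "\<forall>v\<in>set r. m < f v"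
    \<comment> \<open>Integrality turns the strict inequality into a gap of 1.\<close>
    then have "m + 1 \<le> f c" "m + 1 \<le> f d"
      using cd by auto
    then have "of_int m + 1 \<le> F (pos c)" "of_int m + 1 \<le> F (pos d)"
      unfolding F by linarith+
    then have "- F z \<le> - of_int m - 1"
      by (intro closed_segment_extreme(1)[where F = "\<lambda>z. - F z", OF lin' z(2)]) simp_all
    then show False
      using zm by linarith
  qed
  with bel have ge: "m \<le> f c" "m \<le> f d" and uniq: "length (filter (\<lambda>u. f u = m) q) \<le> 1"
     "length (filter (\<lambda>v. f v = m) r) \<le> 1"
    using cd by auto
  from ge have "- F z \<le> - of_int m"
    by (intro closed_segment_extreme(1)[where F = "\<lambda>z. - F z", OF lin' z(2)]) (simp_all add: F)
  then have eq: "F z = m"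
    using zm by linarith
  have "\<not> (f a = m \<and> f b = m)" "\<not> (f c = m \<and> f d = m)"
    using filter_length_le_1D[OF uniq(1) ab(1,2)] filter_length_le_1D[OF uniq(2) cd(1,2)] ab(3) cd(3)
    by blast+
  then have "z = pos a \<or> z = pos b" "z = pos c \<or> z = pos d"
    using closed_segment_extreme(2)[where F = F and m = m, OF lin z(1)]
      closed_segment_extreme(2)[where F = "\<lambda>z. - F z" and m = "- m", OF lin' z(2)] le ge eq
    by (simp_all add: F)
  then show ?thesis
    by auto
qed

lemma apart_segments:
  assumes "apart q r" and "a \<in> set q" "b \<in> set q" "a \<noteq> b" and "c \<in> set r" "d \<in> set r" "c \<noteq> d"
    and "z \<in> closed_segment (pos a) (pos b)" "z \<in> closed_segment (pos c) (pos d)"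
  shows "z \<in> {pos a, pos b} \<inter> {pos c, pos d}"
proof -
  have Re: "Re ((1 - u) *\<^sub>R x + u *\<^sub>R y) = (1 - u) * Re x + u * Re y"
    and Im: "Im ((1 - u) *\<^sub>R x + u *\<^sub>R y) = (1 - u) * Im x + u * Im y" for u x y
    by simp_all
  have pos: "Re (pos p) = of_int (fst p)" "Im (pos p) = of_int (snd p)" for p
    unfolding pos_def by simp_all
  from assms(1) consider "below fst q r" | "below fst r q" | "below snd q r" | "below snd r q"
    unfolding apart_def by blast
  then show ?thesis
  proof cases
    case 1
    show ?thesis by (rule below_segments[OF 1 Re pos(1)]) (fact assms)+
  next
    case 2
    have "z \<in> {pos c, pos d} \<inter> {pos a, pos b}"
      by (rule below_segments[OF 2 Re pos(1)]) (fact assms)+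
    then show ?thesis by blast
  next
    case 3
    show ?thesis by (rule below_segments[OF 3 Im pos(2)]) (fact assms)+
  next
    case 4
    have "z \<in> {pos c, pos d} \<inter> {pos a, pos b}"
      by (rule below_segments[OF 4 Im pos(2)]) (fact assms)+
    then show ?thesis by blast
  qed
qed

text \<open>The extension of \<open>cross\<close> from lattice points to the plane:
  \<open>Im (cnj w * z)\<close> is the cross product of \<open>w\<close> and
  \<open>z\<close>.\<close>

definition side :: "point \<Rightarrow> point \<Rightarrow> complex \<Rightarrow> real" where
  "side a b z = Im (cnj (pos b - pos a) * (z - pos a))"

lemma side_affine: "side a b ((1 - u) *\<^sub>R x + u *\<^sub>R y) = (1 - u) * side a b x + u * side a b y"
  unfolding side_def by (simp add: algebra_simps)

lemma side_pos: "side a b (pos c) = of_int (cross a b c)"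
  unfolding side_def pos_def cross_def by (simp add: algebra_simps)

lemma side_segment: "z \<in> closed_segment (pos a) (pos b) \<Longrightarrow> side a b z = 0"
  unfolding in_segment by (auto simp: side_affine side_pos cross_def)

text \<open>\<open>side a b\<close> vanishes on the first segment; its values at \<open>c\<close>
  and \<open>d\<close> are nonzero integers of equal sign, so on the second segment it stays at
  distance at least 1 from zero.\<close>

lemma same_side_segment:
  assumes pos: "cross a b c * cross a b d > 0" and z: "z \<in> closed_segment (pos c) (pos d)"
  shows "z \<notin> closed_segment (pos a) (pos b)"
proof
  assume zab: "z \<in> closed_segment (pos a) (pos b)"
  have neg: "- side a b ((1 - u) *\<^sub>R x + u *\<^sub>R y) = (1 - u) * - side a b x + u * - side a b y" for u x y
    unfolding side_affine by simp
  from pos consider "cross a b c \<ge> 1" "cross a b d \<ge> 1" | "cross a b c \<le> -1" "cross a b d \<le> -1"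
    unfolding zero_less_mult_iff by linarith
  then show False
  proof cases
    case 1
    then have "- side a b z \<le> -1"
      by (intro closed_segment_extreme(1)[where F = "\<lambda>z. - side a b z", OF neg z]) (simp_all add: side_pos)
    then show False using side_segment[OF zab] by simp
  next
    case 2
    then have "side a b z \<le> -1"
      by (intro closed_segment_extreme(1)[where F = "side a b", OF side_affine z]) (simp_all add: side_pos)
    then show False using side_segment[OF zab] by simp
  qed
qed

lemma noncrossing_segments:
  assumes nc: "noncrossing (a, b) (c, d)" and neq: "a \<noteq> b" "c \<noteq> d"
    and z: "z \<in> closed_segment (pos a) (pos b)" "z \<in> closed_segment (pos c) (pos d)"
  shows "z \<in> {pos a, pos b} \<inter> {pos c, pos d}"
proof -
  have "\<not> cross a b c * cross a b d > 0" "\<not> cross c d a * cross c d b > 0"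
    using same_side_segment z by blast+
  with nc consider "apart [a, b] [c, d]"
    | "a = c \<or> a = d \<or> b = c \<or> b = d" "cross a b c \<noteq> 0 \<or> cross a b d \<noteq> 0"
    unfolding noncrossing.simps by blast
  then show ?thesis
  proof cases
    case 1
    then show ?thesis
      by (rule apart_segments) (use neq z in auto)
  next
    case 2
    have ab: "cross a b a = 0" "cross a b b = 0"
      unfolding cross_def by (simp_all add: algebra_simps)
    obtain u where u: "z = (1 - u) *\<^sub>R pos c + u *\<^sub>R pos d"
      using z(2) unfolding in_segment by blast
    \<comment> \<open>\<open>side\<close> vanishes at \<open>z\<close> and at the shared endpoint
      but not at the other one, so all weight rests on the shared endpoint.\<close>
    have "(1 - u) * cross a b c + u * cross a b d = 0"
      using side_segment[OF z(1)] unfolding u side_affine side_pos .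
    moreover have "c \<in> {a, b} \<and> cross a b d \<noteq> 0 \<or> d \<in> {a, b} \<and> cross a b c \<noteq> 0"
      using 2 ab by auto
    ultimately have "c \<in> {a, b} \<and> u = 0 \<or> d \<in> {a, b} \<and> u = 1"
      using ab by auto
    then show ?thesis
      using u by auto
  qed
qed

section \<open>Families of wheels drawn on the cylinder\<close>

text \<open>A wheel is the list of its hub and its four rim vertices in cyclic order.\<close>

fun segments :: "point list \<Rightarrow> (point \<times> point) list" where
  "segments [h, a, b, c, d] = [(h, a), (h, b), (h, c), (h, d), (a, b), (b, c), (c, d), (d, a)]"
| "segments _ = []"

definition edge :: "point \<times> point \<Rightarrow> point set" where
  "edge s = {node (fst s), node (snd s)}"

definition verts :: "point list set \<Rightarrow> point set" where
  "verts S = node ` (\<Union>q\<in>S. set q)"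

definition segs :: "point list set \<Rightarrow> (point \<times> point) set" where
  "segs S = (\<Union>q\<in>S. set (segments q))"

definition edges :: "point list set \<Rightarrow> point set set" where
  "edges S = edge ` segs S"

text \<open>The bound 16 is half the circumference: two horizontal widths together stay below 32, so
  wrapping identifies no two points on the segments of a wheel, and segments with the same end nodes
  are translated as a whole.\<close>

definition good_wheel :: "point list \<Rightarrow> bool" where
  "good_wheel q \<longleftrightarrow> length q = 5 \<and> distinct q \<and> (\<forall>u\<in>set q. \<forall>v\<in>set q. fst u < fst v + 16) \<and>
     (\<forall>s\<in>set (segments q). \<forall>t\<in>set (segments q). s = t \<or> noncrossing s t)"

text \<open>All translates of \<open>r\<close> occur because the drawing in the cover repeats with
  the circumference; the width bound in \<open>good_wheel\<close> keeps a wheel away from its own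
  translates.\<close>

definition drawn :: "point list set \<Rightarrow> bool" where
  "drawn S \<longleftrightarrow> (\<forall>q\<in>S. good_wheel q) \<and>
     (\<forall>q\<in>S. \<forall>r\<in>S. q \<noteq> r \<longrightarrow> (\<forall>k. apart q (map (turn k) r)))"

lemma list5E:
  fixes q :: "point list"
  assumes "length q = 5"
  obtains h a b c d where "q = [h, a, b, c, d]"
  using assms that by (cases q rule: segments.cases) simp_all

lemma segments_endpoints:
  assumes "(a, b) \<in> set (segments q)"
  shows "a \<in> set q" "b \<in> set q" "distinct q \<Longrightarrow> a \<noteq> b"
proof -
  have "a \<in> set q \<and> b \<in> set q \<and> (distinct q \<longrightarrow> a \<noteq> b)"
  proof (cases q rule: segments.cases)
    case (1 h p r s t)
    then have "(a, b) \<in> {(h, p), (h, r), (h, s), (h, t), (p, r), (r, s), (s, t), (t, p)}"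
      using assms by simp
    with 1 show ?thesis
      by (elim insertE) auto
  qed (use assms in simp_all)
  then show "a \<in> set q" "b \<in> set q" "distinct q \<Longrightarrow> a \<noteq> b"
    by blast+
qed

lemma segments_cover:
  assumes "length q = 5" "u \<in> set q"
  shows "\<exists>(a, b)\<in>set (segments q). u \<in> {a, b}"
proof -
  obtain h a b c d where "q = [h, a, b, c, d]"
    using assms(1) by (rule list5E)
  then show ?thesis
    using assms(2) by (simp add: disj_ac)
qed

lemma segments_card:
  assumes "length q = 5" "distinct q"
  shows "card (set (segments q)) = 8"
proof -
  obtain h a b c d where q: "q = [h, a, b, c, d]"
    using assms(1) by (rule list5E)
  then have "distinct (segments q)"
    using assms(2) by simp
  then show ?thesis
    using distinct_card q by fastforce
qed

lemma Re_pos_segment_less: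
  assumes "z \<in> closed_segment (pos a) (pos b)" "w \<in> closed_segment (pos c) (pos d)"
    and "\<And>u v. u \<in> {a, b} \<Longrightarrow> v \<in> {c, d} \<Longrightarrow> fst u < fst v + n"
  shows "Re z < Re w + of_int n"
proof -
  have lin: "Re ((1 - u) *\<^sub>R x + u *\<^sub>R y) = (1 - u) * Re x + u * Re y"
    "- Re ((1 - u) *\<^sub>R x + u *\<^sub>R y) = (1 - u) * - Re x + u * - Re y" for u and x y :: complex
    by (simp_all add: algebra_simps)
  have z: "Re z \<le> of_int (max (fst a) (fst b))"
    by (rule closed_segment_extreme(1)[where F = Re, OF lin(1) assms(1)]) (simp_all add: pos_def)
  have "- Re w \<le> - of_int (min (fst c) (fst d))"
    by (rule closed_segment_extreme(1)[where F = "\<lambda>z. - Re z", OF lin(2) assms(2)]) (simp_all add: pos_def)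
  moreover have "max (fst a) (fst b) < min (fst c) (fst d) + n"
    using assms(3) by (auto simp: max_def min_def)
  then have "real_of_int (max (fst a) (fst b)) < of_int (min (fst c) (fst d)) + of_int n"
    by linarith
  ultimately show ?thesis
    using z by linarith
qed

lemma translate_segment:
  assumes "w \<in> closed_segment (pos c) (pos d)"
  shows "w + of_int (32 * k) \<in> closed_segment (pos (turn k c)) (pos (turn k d))"
proof -
  obtain u where "0 \<le> u" "u \<le> 1" "w = (1 - u) *\<^sub>R pos c + u *\<^sub>R pos d"
    using assms unfolding in_segment by blast
  then show ?thesis
    unfolding pos_turn in_segment by (intro exI[of _ u]) (simp add: complex_eq_iff algebra_simps)
qed

text \<open>Unwinding the cylinder: two drawn segments that meet on it meet in the cover after a
  translation by a multiple of the circumference.\<close>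

lemma drawn_segments_meet:
  assumes S: "drawn S" and s: "(a, b) \<in> segs S" and t: "(c, d) \<in> segs S"
    and z: "z \<in> closed_segment (pos a) (pos b)" and w: "w \<in> closed_segment (pos c) (pos d)"
    and eq: "cyl z = cyl w"
  shows "(a, b) = (c, d) \<and> z = w \<or> (\<exists>u\<in>{a, b}. \<exists>v\<in>{c, d}. z = pos u \<and> node u = node v)"
proof -
  obtain q r where q: "q \<in> S" "(a, b) \<in> set (segments q)" and r: "r \<in> S" "(c, d) \<in> set (segments r)"
    using s t unfolding segs_def by blast
  have gq: "good_wheel q" and gr: "good_wheel r"
    using S q(1) r(1) unfolding drawn_def by auto
  note ab = segments_endpoints[OF q(2)] and cd = segments_endpoints[OF r(2)]
  have neq: "a \<noteq> b" "c \<noteq> d"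
    using ab(3) cd(3) gq gr unfolding good_wheel_def by auto
  obtain k where k: "z = w + of_int (32 * k)"
    using cyl_eqD[OF eq] by blast
  then have zt: "z \<in> closed_segment (pos (turn k c)) (pos (turn k d))"
    using translate_segment[OF w] by simp
  show ?thesis
  proof (cases "q = r")
    case False
    then have "apart q (map (turn k) r)"
      using S q(1) r(1) unfolding drawn_def by blast
    moreover have "turn k c \<in> set (map (turn k) r)" "turn k d \<in> set (map (turn k) r)"
      using cd by simp_all
    moreover have "turn k c \<noteq> turn k d"
      using neq unfolding turn_def prod_eq_iff by simp
    ultimately have "z \<in> {pos a, pos b} \<inter> {pos (turn k c), pos (turn k d)}"
      using apart_segments[OF _ ab(1,2) neq(1) _ _ _ z zt] by blast
    then obtain u v where "u \<in> {a, b}" "v \<in> {c, d}" "z = pos u" "pos u = pos (turn k v)"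
      by blast
    then show ?thesis
      using inj_pos node_turn by metis
  next
    case True
    have lt: "fst u < fst v + 16" if "u \<in> {a, b, c, d}" "v \<in> {a, b, c, d}" for u v
      using gq that ab cd True unfolding good_wheel_def by auto
    \<comment> \<open>Both points lie on one wheel, so their horizontal distance is below 16 and the
      translation is trivial.\<close>
    have "Re z < Re w + of_int 16" "Re w < Re z + of_int 16"
      by (rule Re_pos_segment_less[OF z w] Re_pos_segment_less[OF w z]; rule lt; blast)+
    then have "k = 0"
      unfolding k by simp
    then have "z = w"
      using k by simp
    have "(a, b) = (c, d) \<or> noncrossing (a, b) (c, d)"
      using gq q r True unfolding good_wheel_def by blast
    then show ?thesis
    proof
      assume "noncrossing (a, b) (c, d)"
      then have "z \<in> {pos a, pos b} \<inter> {pos c, pos d}"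
        using noncrossing_segments[OF _ neq z] w \<open>z = w\<close> by blast
      then obtain u v where "u \<in> {a, b}" "v \<in> {c, d}" "z = pos u" "pos u = pos v"
        by blast
      then show ?thesis
        using inj_pos by metis
    qed (use \<open>z = w\<close> in simp)
  qed
qed

section \<open>Planarity and edge count of a drawn family\<close>

lemma drawn_segD:
  assumes "drawn S" "(a, b) \<in> segs S"
  shows "a \<noteq> b" "fst a < fst b + 16" "fst b < fst a + 16" "node a \<in> verts S" "node b \<in> verts S"
proof -
  obtain q where q: "q \<in> S" "(a, b) \<in> set (segments q)"
    using assms(2) unfolding segs_def by blast
  then have "good_wheel q"
    using assms(1) unfolding drawn_def by blast
  with segments_endpoints[OF q(2)] show "a \<noteq> b" "fst a < fst b + 16" "fst b < fst a + 16"
    unfolding good_wheel_def by blast+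
  show "node a \<in> verts S" "node b \<in> verts S"
    using segments_endpoints(1,2)[OF q(2)] q(1) unfolding verts_def by blast+
qed

lemma drawn_segment_inj:
  assumes "drawn S" "(a, b) \<in> segs S"
  shows "inj_on cyl (closed_segment (pos a) (pos b))"
proof (rule inj_onI)
  fix z w assume z: "z \<in> closed_segment (pos a) (pos b)" and w: "w \<in> closed_segment (pos a) (pos b)"
    and "cyl z = cyl w"
  then obtain k where k: "z = w + of_int (32 * k)"
    using cyl_eqD by blast
  have lt: "fst u < fst v + 16" if "u \<in> {a, b}" "v \<in> {a, b}" for u v
    using drawn_segD(2,3)[OF assms] that by auto
  have "Re z < Re w + of_int 16" "Re w < Re z + of_int 16"
    by (rule Re_pos_segment_less[OF z w] Re_pos_segment_less[OF w z]; rule lt; blast)+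
  then have "k = 0"
    unfolding k by simp
  then show "z = w"
    using k by simp
qed

lemma node_neq:
  assumes "drawn S" "(a, b) \<in> segs S"
  shows "node a \<noteq> node b"
proof
  assume "node a = node b"
  then have "pos a = pos b"
    using inj_onD[OF drawn_segment_inj[OF assms], of "pos a" "pos b"] by (simp add: cyl_pos_eq_iff)
  then show False
    using inj_pos drawn_segD(1)[OF assms] by blast
qed

lemma node_verts: "v \<in> verts S \<Longrightarrow> node v = v"
  unfolding verts_def node_def by auto

text \<open>Each edge is drawn as the image under \<open>cyl\<close> of a segment chosen in the
  cover; \<open>drawn_segments_meet\<close> reduces the conditions on vertices and crossings to
  common endpoints.\<close>

lemma planar_drawn:
  assumes S: "drawn S"
  shows "planar (verts S) (edges S)"
proof -
  define p where "p v = cyl (pos v)" for v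
  define seg where "seg e = (SOME s. s \<in> segs S \<and> edge s = e)" for e
  define \<gamma> where "\<gamma> e = cyl \<circ> linepath (pos (fst (seg e))) (pos (snd (seg e)))" for e
  have seg: "seg e \<in> segs S" "edge (seg e) = e" if "e \<in> edges S" for e
    using someI_ex[of "\<lambda>s. s \<in> segs S \<and> edge s = e"] that unfolding seg_def edges_def by blast+
  have image: "path_image (\<gamma> e) = cyl ` closed_segment (pos (fst (seg e))) (pos (snd (seg e)))" for e
    unfolding \<gamma>_def path_image_compose by simp
  have inj: "inj_on p (verts S)"
    unfolding inj_on_def p_def cyl_pos_eq_iff using node_verts by metis
  have arc: "arc (\<gamma> e)" if "e \<in> edges S" for e
  proof -
    obtain a b where ab: "seg e = (a, b)"
      by (cases "seg e")
    then have s: "(a, b) \<in> segs S"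
      using seg(1)[OF that] by simp
    then have "pos a \<noteq> pos b"
      using drawn_segD(1)[OF S] inj_pos by blast
    then have "arc (linepath (pos a) (pos b))"
      by (rule arc_linepath)
    moreover from this have "inj_on (cyl \<circ> linepath (pos a) (pos b)) {0..1}"
      using drawn_segment_inj[OF S s] unfolding arc_def
      by (intro comp_inj_on) (simp_all flip: path_image_def)
    ultimately show ?thesis
      unfolding arc_def \<gamma>_def ab using continuous_on_cyl by (auto intro: path_continuous_image)
  qed
  have meet: "\<exists>u\<in>{fst (seg e), snd (seg e)}. z = pos u \<and> (\<exists>v\<in>{c, d}. node u = node v)"
    if e: "e \<in> edges S" and cd: "(c, d) \<in> segs S" and "seg e \<noteq> (c, d)"
      and "z \<in> closed_segment (pos (fst (seg e))) (pos (snd (seg e)))"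
      and "w \<in> closed_segment (pos c) (pos d)" and "cyl z = cyl w" for e c d z w
    using drawn_segments_meet[OF S _ cd that(4,5,6)] seg(1)[OF e] that(3) by auto
  have vert: "w \<in> e" if e: "e \<in> edges S" and w: "w \<in> verts S" and pw: "p w \<in> path_image (\<gamma> e)" for e w
  proof -
    obtain z where z: "z \<in> closed_segment (pos (fst (seg e))) (pos (snd (seg e)))" "p w = cyl z"
      using pw unfolding image by blast
    obtain q u where q: "q \<in> S" "u \<in> set q" "w = node u"
      using w unfolding verts_def by blast
    then have "length q = 5"
      using S unfolding drawn_def good_wheel_def by blast
    \<comment> \<open>Every vertex ends some segment, so a vertex on an arc becomes a case of two
      meeting segments.\<close>
    then obtain c d where cd: "(c, d) \<in> segs S" "u \<in> {c, d}"
      using segments_cover[OF _ q(2)] q(1) unfolding segs_def by blast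
    have eq: "cyl z = cyl (pos u)"
      using z(2) q(3) unfolding p_def by (simp add: cyl_pos_node)
    have "\<exists>u\<in>{fst (seg e), snd (seg e)}. z = pos u"
    proof (cases "seg e = (c, d)")
      case True
      have "u \<in> {fst (seg e), snd (seg e)}"
        using cd(2) True by simp
      moreover from this have "z = pos u"
        using inj_onD[OF drawn_segment_inj[OF S cd(1)] eq] z(1) True by auto
      ultimately show ?thesis
        by blast
    next
      case False
      have "pos u \<in> closed_segment (pos c) (pos d)"
        using cd(2) by auto
      from meet[OF e cd(1) False z(1) this eq] show ?thesis
        by blast
    qed
    then obtain x where x: "x \<in> {fst (seg e), snd (seg e)}" "z = pos x"
      by blast
    then have "node x = w"
      using eq q(3) by (simp add: cyl_pos_eq_iff)
    then show ?thesis
      using x(1) seg(2)[OF e] unfolding edge_def by auto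
  qed
  have cr: "path_image (\<gamma> e) \<inter> path_image (\<gamma> f) \<subseteq> p ` (e \<inter> f)"
    if e: "e \<in> edges S" and f: "f \<in> edges S" and "e \<noteq> f" for e f
  proof
    fix y assume "y \<in> path_image (\<gamma> e) \<inter> path_image (\<gamma> f)"
    then obtain z w where zw: "y = cyl z" "cyl z = cyl w"
        "z \<in> closed_segment (pos (fst (seg e))) (pos (snd (seg e)))"
        "w \<in> closed_segment (pos (fst (seg f))) (pos (snd (seg f)))"
      unfolding image by auto
    have "seg e \<noteq> (fst (seg f), snd (seg f))" "(fst (seg f), snd (seg f)) \<in> segs S"
      using seg(2)[OF e] seg(2)[OF f] seg(1)[OF f] \<open>e \<noteq> f\<close> by force+
    from meet[OF e this(2,1) zw(3,4,2)] obtain u v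
      where u: "u \<in> {fst (seg e), snd (seg e)}" "z = pos u"
        and v: "v \<in> {fst (seg f), snd (seg f)}" "node u = node v"
      by blast
    have "node u \<in> e \<inter> f"
      using u(1) v seg(2)[OF e] seg(2)[OF f] unfolding edge_def by auto
    moreover have "y = p (node u)"
      unfolding p_def zw(1) u(2) by (simp add: cyl_pos_node)
    ultimately show "y \<in> p ` (e \<inter> f)"
      by blast
  qed
  have ends: "\<exists>u v. e = {u, v} \<and> arc (\<gamma> e) \<and> pathstart (\<gamma> e) = p u \<and> pathfinish (\<gamma> e) = p v"
    if e: "e \<in> edges S" for e
  proof (intro exI conjI)
    show "e = {node (fst (seg e)), node (snd (seg e))}"
      using seg(2)[OF e] unfolding edge_def by simp
    show "pathstart (\<gamma> e) = p (node (fst (seg e)))" "pathfinish (\<gamma> e) = p (node (snd (seg e)))"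
      unfolding \<gamma>_def p_def cyl_pos_node by (simp_all add: pathstart_compose pathfinish_compose)
  qed (rule arc[OF e])
  show ?thesis
    unfolding planar_def
  proof (intro exI[of _ p] exI[of _ \<gamma>] conjI ballI impI)
    show "inj_on p (verts S)"
      by (rule inj)
  qed (fact ends, fact vert, fact cr)
qed

lemma simple_graph_drawn:
  assumes "finite S" "drawn S"
  shows "simple_graph (verts S) (edges S)"
  unfolding simple_graph_def
proof (intro conjI ballI)
  show "finite (verts S)"
    using assms(1) unfolding verts_def by simp
  fix e assume "e \<in> edges S"
  then obtain a b where "(a, b) \<in> segs S" "e = {node a, node b}"
    unfolding edges_def edge_def by auto
  then show "\<exists>u v. u \<in> verts S \<and> v \<in> verts S \<and> u \<noteq> v \<and> e = {u, v}"
    using drawn_segD(4,5)[OF assms(2)] node_neq[OF assms(2)] by blast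
qed

lemma midpoint_not_end:
  assumes "a \<noteq> b"
  shows "midpoint (pos a) (pos b) \<noteq> pos a" "midpoint (pos a) (pos b) \<noteq> pos b"
  using assms inj_pos[of a b] by (auto simp: midpoint_eq_endpoint)

text \<open>Segments with the same end nodes are translates up to orientation, so their midpoints
  agree on the cylinder. A meeting point that is no endpoint forces the segments to be
  equal.\<close>

lemma inj_on_edge_drawn:
  assumes S: "drawn S"
  shows "inj_on edge (segs S)"
proof (rule inj_onI)
  fix s t assume st: "s \<in> segs S" "t \<in> segs S" "edge s = edge t"
  obtain a b c d where ab: "s = (a, b)" and cd: "t = (c, d)"
    by (cases s, cases t)
  note s = st(1)[unfolded ab] and t = st(2)[unfolded cd]
  have "{node a, node b} = {node c, node d}"
    using st(3) unfolding ab cd edge_def by simp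
  then obtain a' b' where a'b': "(a', b') = (a, b) \<or> (a', b') = (b, a)" and nodes: "node a' = node c" "node b' = node d"
    by (metis doubleton_eq_iff)
  obtain k l where k: "a' = turn k c" and l: "b' = turn l d"
    using node_eqD nodes by metis
  have "fst a' < fst b' + 16" "fst b' < fst a' + 16" "fst c < fst d + 16" "fst d < fst c + 16"
    using drawn_segD(2,3)[OF S s] drawn_segD(2,3)[OF S t] a'b' by auto
  \<comment> \<open>\<open>32 * (k - l)\<close> is a difference of two signed widths, each below 16
    in size.\<close>
  then have "k = l"
    unfolding k l turn_def by simp
  then have "midpoint (pos a') (pos b') = midpoint (pos c) (pos d) + of_int (32 * k)"
    unfolding k l pos_turn midpoint_def by (simp add: complex_eq_iff)
  then have eq: "cyl (midpoint (pos a) (pos b)) = cyl (midpoint (pos c) (pos d))"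
    using a'b' cyl_turn[of "midpoint (pos c) (pos d)" k] by (auto simp: midpoint_sym)
  have "midpoint (pos a) (pos b) \<in> closed_segment (pos a) (pos b)"
    "midpoint (pos c) (pos d) \<in> closed_segment (pos c) (pos d)"
    by simp_all
  from drawn_segments_meet[OF S s t this eq] show "s = t"
    using midpoint_not_end[OF drawn_segD(1)[OF S s]] unfolding ab cd by auto
qed

lemma turn_0: "turn 0 = id"
  unfolding turn_def by (simp add: fun_eq_iff)

text \<open>Distinct wheels share no segment, since its midpoint would have to be an endpoint. As
  \<open>edge\<close> is injective, each wheel contributes eight edges of its own.\<close>

lemma card_edges_drawn:
  assumes fin: "finite S" and S: "drawn S"
  shows "card (edges S) = 8 * card S"
proof -
  have disj: "set (segments q) \<inter> set (segments r) = {}" if q: "q \<in> S" and r: "r \<in> S" and "q \<noteq> r" for q r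
  proof (rule ccontr)
    assume "set (segments q) \<inter> set (segments r) \<noteq> {}"
    then obtain a b where ab: "(a, b) \<in> set (segments q)" "(a, b) \<in> set (segments r)"
      by auto
    have neq: "a \<noteq> b"
      using segments_endpoints(3)[OF ab(1)] S q unfolding drawn_def good_wheel_def by blast
    have "apart q (map (turn 0) r)"
      using S q r \<open>q \<noteq> r\<close> unfolding drawn_def by blast
    then have "apart q r"
      by (simp add: turn_0)
    note apart_segments[OF this segments_endpoints(1,2)[OF ab(1)] neq segments_endpoints(1,2)[OF ab(2)] neq,
        of "midpoint (pos a) (pos b)"]
    then show False
      using midpoint_not_end[OF neq] by simp
  qed
  have "card (edges S) = card (segs S)"
    unfolding edges_def by (rule card_image) (rule inj_on_edge_drawn[OF S])
  also have "\<dots> = (\<Sum>q\<in>S. card (set (segments q)))"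
    unfolding segs_def using fin disj by (intro card_UN_disjoint) auto
  also have "\<dots> = (\<Sum>q\<in>S. 8)"
    using S segments_card unfolding drawn_def good_wheel_def by (intro sum.cong) auto
  finally show ?thesis
    by simp
qed

section \<open>The wheels\<close>

text \<open>16 is the height of one \<open>period\<close>, so successive copies meet along a common
  row of vertices.\<close>

definition lift :: "int \<Rightarrow> point \<Rightarrow> point" where
  "lift k p = (fst p, snd p + 16 * k)"

text \<open>The wheels form rings around the cylinder, consecutive wheels of a ring sharing a rim vertex;
  neighbouring rings share six vertices at heights \<open>16 k + 4\<close> and \<open>16 k + 12\<close>.
  \<open>bottom\<close> is one ring of 6 wheels, \<open>period\<close> consists of a ring of 12 and a ring of 9 wheels, and
  \<open>top_cap\<close> of a ring of 6 wheels together with two wheels inserted below it. The rings were found by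
  a computer search for patterns in which all remaining faces have length 7 and which can be stacked
  periodically.\<close>

definition bottom :: "point list list" where
  "bottom =
    [[(3, 0), (9, 0), (8, 4), (2, 0), (3, -1)],
     [(10, 1), (14, 0), (13, 4), (10, 2), (9, 0)],
     [(15, 1), (19, 0), (18, 4), (15, 2), (14, 0)],
     [(20, 1), (24, 0), (23, 4), (20, 2), (19, 0)],
     [(25, 1), (29, 0), (28, 4), (25, 2), (24, 0)],
     [(30, 1), (34, 0), (33, 4), (30, 2), (29, 0)]]"

definition period :: "point list list" where
  "period =
    [[(6, 8), (9, 8), (6, 12), (5, 8), (8, 4)],
     [(10, 8), (12, 8), (11, 12), (9, 8), (10, 7)],
     [(13, 8), (14, 8), (13, 9), (12, 8), (13, 4)],
     [(15, 8), (17, 8), (16, 12), (14, 8), (15, 7)],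
     [(18, 8), (19, 8), (18, 9), (17, 8), (18, 4)],
     [(20, 8), (22, 8), (21, 12), (19, 8), (20, 7)],
     [(23, 8), (24, 8), (23, 9), (22, 8), (23, 4)],
     [(25, 8), (27, 8), (26, 12), (24, 8), (25, 7)],
     [(28, 8), (29, 8), (28, 9), (27, 8), (28, 4)],
     [(30, 8), (32, 8), (31, 12), (29, 8), (30, 7)],
     [(33, 7), (35, 8), (32, 8), (33, 4), (34, 7)],
     [(36, 8), (37, 8), (36, 9), (35, 8), (36, 7)],
     [(1, 16), (7, 16), (1, 20), (0, 16), (6, 12)],
     [(8, 16), (9, 16), (8, 20), (7, 16), (8, 15)],
     [(10, 15), (12, 16), (9, 16), (10, 14), (11, 12)],
     [(13, 17), (15, 16), (14, 17), (13, 20), (12, 16)],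
     [(16, 16), (19, 16), (18, 20), (15, 16), (16, 12)],
     [(20, 15), (22, 16), (19, 16), (20, 14), (21, 12)],
     [(23, 17), (25, 16), (24, 17), (23, 20), (22, 16)],
     [(26, 16), (29, 16), (28, 20), (25, 16), (26, 12)],
     [(30, 15), (32, 16), (29, 16), (30, 14), (31, 12)]]"

definition top_cap :: "point list list" where
  "top_cap =
    [[(8, 5), (9, 5), (8, 6), (7, 5), (8, 4)],
     [(23, 5), (24, 5), (23, 6), (22, 5), (23, 4)],
     [(4, 7), (9, 8), (2, 8), (3, 7), (8, 6)],
     [(11, 7), (15, 8), (9, 8), (13, 4), (12, 7)],
     [(16, 7), (19, 8), (15, 8), (16, 6), (18, 4)],
     [(20, 8), (24, 8), (20, 9), (19, 8), (23, 6)],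
     [(26, 7), (30, 8), (24, 8), (28, 4), (27, 7)],
     [(31, 7), (34, 8), (30, 8), (31, 6), (33, 4)]]"

text \<open>\<open>period\<close> and \<open>top_cap\<close> are both given at heights that fit
  directly onto \<open>bottom\<close>, so the lift is the number of periods underneath.\<close>

definition layer :: "nat \<Rightarrow> nat \<Rightarrow> point list list" where
  "layer J i = (if i = 0 then bottom else if i \<le> J then map (map (lift (int i - 1))) period
     else map (map (lift (int J))) top_cap)"

definition wheels :: "nat \<Rightarrow> point list list" where
  "wheels J = concat (map (layer J) [0..<J + 2])"

section \<open>Invariance under vertical translation\<close>

lemma fst_lift [simp]: "fst (lift k p) = fst p" and snd_lift [simp]: "snd (lift k p) = snd p + 16 * k"
  unfolding lift_def by simp_all

lemma inj_lift: "inj (lift k)"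
  unfolding inj_def lift_def by (simp add: prod_eq_iff)

lemma lift_lift: "lift k (lift l p) = lift (k + l) p"
  unfolding lift_def by (simp add: algebra_simps)

lemma lift_comp: "lift k \<circ> lift l = lift (k + l)"
  by (simp add: fun_eq_iff lift_lift)

lemma lift_0: "lift 0 = id"
  unfolding lift_def by (simp add: fun_eq_iff)

lemma node_lift: "node (lift k p) = lift k (node p)"
  unfolding node_def lift_def by simp

lemma turn_lift: "turn l (lift k p) = lift k (turn l p)"
  unfolding turn_def lift_def by simp

lemma segments_map: "segments (map f q) = map (map_prod f f) (segments q)"
  by (cases q rule: segments.cases) simp_all

lemma edges_lift: "edges (map (lift k) ` S) = (`) (lift k) ` edges S"
proof -
  have "segs (map (lift k) ` S) = map_prod (lift k) (lift k) ` segs S"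
    unfolding segs_def by (simp add: segments_map image_UN)
  moreover have "edge (map_prod (lift k) (lift k) s) = lift k ` edge s" for s
    unfolding edge_def by (simp add: node_lift)
  ultimately show ?thesis
    unfolding edges_def by (simp add: image_image)
qed

lemma verts_lift: "verts (map (lift k) ` S) = lift k ` verts S"
  unfolding verts_def by (simp add: image_UN image_image node_lift)

lemma below_lift:
  assumes "below f q r" "q \<noteq> []" "f = fst \<or> f = snd"
  shows "below f (map (lift k) q) (map (lift k) r)"
proof -
  obtain c where c: "\<And>p. f (lift k p) = f p + c"
    using assms(3) by (metis fst_lift snd_lift add.right_neutral)
  have "Max (f ` set (map (lift k) q)) = Max (f ` set q) + c"
    using Max_add_commute[of "set q" f c] assms(2) by (simp add: image_image c)
  then show ?thesis
    using assms(1) unfolding below_def Let_def by (simp add: c filter_map o_def)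
qed

lemma apart_lift:
  assumes "apart q r" "q \<noteq> []" "r \<noteq> []"
  shows "apart (map (lift k) q) (map (lift k) r)"
  using assms below_lift unfolding apart_def by blast

lemma cross_lift: "cross (lift k a) (lift k b) (lift k c) = cross a b c"
  unfolding cross_def by simp

lemma noncrossing_lift:
  assumes "noncrossing s t"
  shows "noncrossing (map_prod (lift k) (lift k) s) (map_prod (lift k) (lift k) t)"
proof -
  obtain a b c d where "s = (a, b)" "t = (c, d)"
    by (cases s, cases t)
  then show ?thesis
    using assms apart_lift[of "[a, b]" "[c, d]" k] injD[OF inj_lift, of k]
    by (auto simp: cross_lift)
qed

lemma good_wheel_lift:
  assumes "good_wheel q"
  shows "good_wheel (map (lift k) q)"
proof -
  have "inj_on (lift k) (set q)"
    using inj_lift by (rule inj_on_subset) simp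
  moreover have "s = t \<or> noncrossing s t"
    if s: "s \<in> set (segments (map (lift k) q))" and t: "t \<in> set (segments (map (lift k) q))" for s t
  proof -
    from s[unfolded segments_map set_map] obtain s'
      where s': "s = map_prod (lift k) (lift k) s'" "s' \<in> set (segments q)"
      by (rule imageE)
    from t[unfolded segments_map set_map] obtain t'
      where t': "t = map_prod (lift k) (lift k) t'" "t' \<in> set (segments q)"
      by (rule imageE)
    have "\<forall>s\<in>set (segments q). \<forall>t\<in>set (segments q). s = t \<or> noncrossing s t"
      using assms unfolding good_wheel_def by (elim conjE)
    from this[rule_format, OF s'(2) t'(2)] show ?thesis
      unfolding s'(1) t'(1) by (elim disjE) (simp, intro disjI2 noncrossing_lift)
  qed
  ultimately show ?thesis
    using assms unfolding good_wheel_def by (simp add: distinct_map del: noncrossing.simps)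
qed

section \<open>Finite checks on the blocks by evaluation\<close>

definition separated :: "point list list \<Rightarrow> bool" where
  "separated Q \<longleftrightarrow> (\<forall>q\<in>set Q. \<forall>r\<in>set Q. q = r \<or> (\<forall>k\<in>{-1, 0, 1}. apart q (map (turn k) r)))"

text \<open>All first coordinates lie within two circumferences, so a translation by two or more
  turns is separated by a vertical line; \<open>separated\<close> tests the remaining ones.\<close>

definition near_seam :: "point list list \<Rightarrow> bool" where
  "near_seam Q \<longleftrightarrow> (\<forall>q\<in>set Q. \<forall>u\<in>set q. 0 \<le> fst u \<and> fst u < 64)"

lemma good_wheels: "\<forall>q\<in>set (wheels 0 @ wheels 2). good_wheel q"
  by code_simp

lemma near_seam_wheels: "near_seam (wheels 0 @ wheels 2)"
  by code_simp

lemma separated_0: "separated (wheels 0)"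
  by code_simp

lemma separated_2: "separated (wheels 2)"
  by code_simp

text \<open>Hubs strictly inside the strip tell the layers apart; the bound 4 on the rise of an edge
  keeps a hexagon within height 12.\<close>

definition confined :: "int \<Rightarrow> int \<Rightarrow> point list list \<Rightarrow> bool" where
  "confined m n Q \<longleftrightarrow> (\<forall>q\<in>set Q. m < snd (hd q) \<and> snd (hd q) < n \<and>
     (\<forall>u\<in>set q. m \<le> snd u \<and> snd u \<le> n) \<and> (\<forall>(u, v)\<in>set (segments q). \<bar>snd u - snd v\<bar> \<le> 4))"

text \<open>The bounds make layer \<open>i\<close> range from \<open>16 i - 12\<close> to
  \<open>16 i + 4\<close>; the value -12 for \<open>bottom\<close> is this formula at
  \<open>i = 0\<close>.\<close>

lemma confined_blocks: "confined (-12) 4 bottom" "confined 4 20 period" "confined 4 20 top_cap"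
  by code_simp+

lemma blocks_distinct: "distinct bottom \<and> distinct period \<and> distinct top_cap"
  by code_simp

lemma blocks_length: "length bottom = 6 \<and> length period = 21 \<and> length top_cap = 8"
  by code_simp

text \<open>Height 4 is the row shared with the block underneath, so these are the vertices that a
  block adds.\<close>

definition fresh :: "point list list \<Rightarrow> point list" where
  "fresh Q = remdups (filter (\<lambda>v. 4 < snd v) (map node (concat Q)))"

lemma fresh_length:
  "length (remdups (map node (concat bottom))) = 24 \<and> length (fresh period) = 72 \<and> length (fresh top_cap) = 26"
  by code_simp

text \<open>A block rests either on \<open>bottom\<close> or on a \<open>period\<close> one level
  lower; in both cases its boundary vertices must already occur there.\<close>

definition shared :: "point list list \<Rightarrow> bool" where
  "shared Q \<longleftrightarrow> (\<forall>v\<in>set (filter (\<lambda>v. snd v \<le> 4) (map node (concat Q))).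
     v \<in> set (map node (concat bottom)) \<and> lift 1 v \<in> set (map node (concat period)))"

lemma shared_blocks: "shared (period @ top_cap)"
  by code_simp

lemma bottom_above: "\<forall>v\<in>set (map node (concat bottom)). -12 < snd v"
  by code_simp

section \<open>Assembling the layers from windows of two\<close>

lemma set_wheels: "set (wheels J) = (\<Union>i\<le>Suc J. set (layer J i))"
proof -
  have "{0..<J + 2} = {..Suc J}"
    by auto
  then show ?thesis
    unfolding wheels_def set_concat set_map set_upt by (simp only: image_image)
qed

text \<open>This reduces all local properties to the two graphs with \<open>J = 0\<close> and \<open>J = 2\<close>.\<close>

lemma layer_window:
  assumes "i \<le> J"
  shows "\<exists>K\<in>{0, 2}. \<exists>k. set (layer J i) \<union> set (layer J (Suc i)) \<subseteq> map (lift k) ` set (wheels K)"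
proof -
  have w0: "set (wheels 0) = set bottom \<union> set top_cap"
    unfolding set_wheels by (simp add: layer_def lift_0 atMost_Suc Un_commute)
  have w2: "set (wheels 2) = set bottom \<union> set period \<union> map (lift 1) ` set period \<union> map (lift 2) ` set top_cap"
    unfolding set_wheels by (simp add: layer_def lift_0 atMost_Suc numeral_2_eq_2 Un_ac)
  \<comment> \<open>The pairs of consecutive layers are bottom and cap, bottom and period, two
    periods, period and cap. The first occurs in \<open>wheels 0\<close>, the others in
    \<open>wheels 2\<close>.\<close>
  consider "J = 0" | "J > 0" "i = 0" | "i > 0" "i < J" | "i > 0" "i = J"
    using assms by linarith
  then show ?thesis
  proof cases
    case 1
    then have "set (layer J i) \<union> set (layer J (Suc i)) \<subseteq> map (lift 0) ` set (wheels 0)"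
      using assms unfolding w0 by (auto simp: layer_def lift_0)
    then show ?thesis by blast
  next
    case 2
    then have "set (layer J i) \<union> set (layer J (Suc i)) \<subseteq> map (lift 0) ` set (wheels 2)"
      unfolding w2 by (auto simp: layer_def lift_0)
    then show ?thesis by blast
  next
    case 3
    then have "set (layer J i) \<union> set (layer J (Suc i)) \<subseteq> map (lift (int i - 1)) ` set (wheels 2)"
      unfolding w2 by (auto simp: layer_def image_Un image_image lift_comp)
    then show ?thesis by blast
  next
    case 4
    then have "set (layer J i) \<union> set (layer J (Suc i)) \<subseteq> map (lift (int i - 2)) ` set (wheels 2)"
      unfolding w2 by (auto simp: layer_def image_Un image_image lift_comp)
    then show ?thesis by blast
  qed
qed

lemma layer_confined:
  assumes "i \<le> Suc J"
  shows "confined (16 * int i - 12) (16 * int i + 4) (layer J i)"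
proof -
  have up: "confined (m + 16 * k) (n + 16 * k) (map (map (lift k)) Q)"
    if "confined m n Q" "\<forall>q\<in>set Q. q \<noteq> []" for m n k Q
    using that unfolding confined_def case_prod_unfold by (auto simp: hd_map segments_map)
  have ne: "\<forall>q\<in>set period. q \<noteq> []" "\<forall>q\<in>set top_cap. q \<noteq> []"
    unfolding period_def top_cap_def by simp_all
  consider "i = 0" | "0 < i" "i \<le> J" | "i = Suc J"
    using assms by linarith
  then show ?thesis
  proof cases
    case 1
    then show ?thesis using confined_blocks(1) by (simp add: layer_def)
  next
    case 2
    then show ?thesis using up[OF confined_blocks(2) ne(1), of "int i - 1"] by (simp add: layer_def algebra_simps)
  next
    case 3
    then show ?thesis using up[OF confined_blocks(3) ne(2), of "int J"] by (simp add: layer_def algebra_simps)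
  qed
qed

lemma below_strict:
  assumes "q \<noteq> []" "\<And>u v. u \<in> set q \<Longrightarrow> v \<in> set r \<Longrightarrow> f u < f v"
  shows "below f q r"
proof -
  have "Max (f ` set q) \<in> f ` set q"
    using assms(1) by (intro Max_in) simp_all
  then show ?thesis
    using assms(2) unfolding below_def Let_def by auto
qed

lemma good_wheelsD: "K \<in> {0, 2} \<Longrightarrow> q \<in> set (wheels K) \<Longrightarrow> good_wheel q"
  using good_wheels unfolding set_append by blast

lemma good_wheel_nonempty: "good_wheel q \<Longrightarrow> q \<noteq> []"
  unfolding good_wheel_def by auto

lemma apart_turn:
  assumes K: "K \<in> {0, 2}" and q: "q \<in> set (wheels K)" and r: "r \<in> set (wheels K)" and "q \<noteq> r"
  shows "apart q (map (turn k) r)"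
proof -
  have ne: "q \<noteq> []" "r \<noteq> []"
    using good_wheelsD[OF K q] good_wheelsD[OF K r] by (simp_all add: good_wheel_nonempty)
  have bounds: "0 \<le> fst u" "fst u < 64" if "u \<in> set q \<union> set r" for u
    using near_seam_wheels that q r K unfolding near_seam_def by auto
  consider "k \<in> {-1, 0, 1}" | "k \<ge> 2" | "k \<le> -2"
    by force
  then show ?thesis
  proof cases
    case 1
    then show ?thesis
      using separated_0 separated_2 K q r \<open>q \<noteq> r\<close> unfolding separated_def by blast
  next
    case 2
    have "below fst q (map (turn k) r)"
      using bounds 2 by (intro below_strict[OF ne(1)]) (fastforce simp: turn_def)
    then show ?thesis unfolding apart_def by blast
  next
    case 3
    have "below fst (map (turn k) r) q"
      using bounds 3 ne(2) by (intro below_strict) (fastforce simp: turn_def)+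
    then show ?thesis unfolding apart_def by blast
  qed
qed

lemma good_wheel_layer:
  assumes "i \<le> Suc J" "q \<in> set (layer J i)"
  shows "good_wheel q"
proof -
  \<comment> \<open>With \<open>min i J\<close> the cap becomes the upper half of the last
    window.\<close>
  have "q \<in> set (layer J (min i J)) \<union> set (layer J (Suc (min i J)))"
    using assms by (cases "i \<le> J") (auto simp: min_def le_Suc_eq)
  then obtain K k where "K \<in> {0, 2}" "q \<in> map (lift k) ` set (wheels K)"
    using layer_window[OF min.cobounded2] by blast
  then show ?thesis
    using good_wheelsD good_wheel_lift by blast
qed

text \<open>Layers at most one apart lie in a common window, where separation was evaluated.
  Otherwise \<open>16 i + 4 < 16 j - 12\<close> leaves a horizontal gap.\<close>

lemma apart_layers:
  assumes ij: "i \<le> j" "j \<le> Suc J" and q: "q \<in> set (layer J i)" and r: "r \<in> set (layer J j)"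
    and "q \<noteq> r"
  shows "apart q (map (turn k) r)" "apart r (map (turn k) q)"
proof -
  have ne: "q \<noteq> []" "r \<noteq> []"
    using good_wheel_layer[OF _ q] good_wheel_layer[OF _ r] ij by (auto intro!: good_wheel_nonempty)
  have "apart q (map (turn k) r) \<and> apart r (map (turn k) q)"
  proof (cases "j \<le> Suc i")
    case True
    define m where "m = min i J"
    have "{q, r} \<subseteq> set (layer J m) \<union> set (layer J (Suc m))"
      using ij q r True unfolding m_def min_def by (auto simp: le_Suc_eq)
    moreover have "m \<le> J"
      unfolding m_def by simp
    ultimately obtain K l where K: "K \<in> {0, 2}" and "{q, r} \<subseteq> map (lift l) ` set (wheels K)"
      using layer_window by (meson subset_trans)
    then obtain q' r' where q': "q' \<in> set (wheels K)" "q = map (lift l) q'"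
      and r': "r' \<in> set (wheels K)" "r = map (lift l) r'"
      by auto
    then have "apart q' (map (turn k) r')" "apart r' (map (turn k) q')"
      using apart_turn[OF K] \<open>q \<noteq> r\<close> by auto
    then have "apart (map (lift l) q') (map (lift l) (map (turn k) r'))"
      "apart (map (lift l) r') (map (lift l) (map (turn k) q'))"
      using apart_lift[of q' "map (turn k) r'" l] apart_lift[of r' "map (turn k) q'" l] ne q' r' by auto
    then show ?thesis
      using q'(2) r'(2) by (simp add: turn_lift o_def)
  next
    case False
    have "snd u \<le> 16 * int i + 4" if "u \<in> set q" for u
      using layer_confined[of i J] ij q that unfolding confined_def by auto
    moreover have "16 * int j - 12 \<le> snd v" if "v \<in> set r" for v
      using layer_confined[of j J] ij r that unfolding confined_def by auto
    ultimately have lt: "snd u < snd v" if "u \<in> set q" "v \<in> set r" for u v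
      using that False by fastforce
    have "below snd q (map (turn k) r)" "below snd (map (turn k) q) r"
      using ne lt by (auto intro!: below_strict simp: turn_def)
    then show ?thesis
      unfolding apart_def by blast
  qed
  then show "apart q (map (turn k) r)" "apart r (map (turn k) q)"
    by blast+
qed

lemma drawn_wheels: "drawn (set (wheels J))"
  unfolding drawn_def
proof (intro conjI ballI impI allI)
  show "good_wheel q" if "q \<in> set (wheels J)" for q
    using that good_wheel_layer unfolding set_wheels by auto
  fix q r k assume "q \<in> set (wheels J)" "r \<in> set (wheels J)" "q \<noteq> r"
  then obtain i j where i: "i \<le> Suc J" "q \<in> set (layer J i)" and j: "j \<le> Suc J" "r \<in> set (layer J j)"
    unfolding set_wheels by blast
  show "apart q (map (turn k) r)"
    using apart_layers[of i j J q r] apart_layers[of j i J r q] i j \<open>q \<noteq> r\<close> by (cases "i \<le> j") auto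
qed

section \<open>Counting\<close>

lemma card_layer:
  "card (set (layer J i)) = (if i = 0 then 6 else if i \<le> J then 21 else 8)"
proof -
  have "inj_on (map (lift k)) A" for k A
    using inj_lift by (simp add: inj_on_def inj_def)
  then show ?thesis
    using blocks_distinct blocks_length unfolding layer_def by (simp add: card_image distinct_card)
qed

text \<open>Hub heights lie in disjoint open strips, so no wheel belongs to two layers; bottom and
  cap give \<open>6 + 8 = 14\<close>.\<close>

lemma card_wheels: "card (set (wheels J)) = 14 + 21 * J"
proof -
  have "set (layer J i) \<inter> set (layer J j) = {}" if "i \<le> Suc J" "j \<le> Suc J" "i \<noteq> j" for i j
  proof -
    have "i = j" if "q \<in> set (layer J i)" "q \<in> set (layer J j)" for q
      using layer_confined[of i J] layer_confined[of j J] \<open>i \<le> Suc J\<close> \<open>j \<le> Suc J\<close> that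
      unfolding confined_def by fastforce
    then show ?thesis
      using \<open>i \<noteq> j\<close> by blast
  qed
  then have "card (set (wheels J)) = (\<Sum>i\<le>Suc J. card (set (layer J i)))"
    unfolding set_wheels by (intro card_UN_disjoint) auto
  also have "\<dots> = (\<Sum>i\<le>J. card (set (layer J i))) + 8"
    by (simp add: card_layer)
  also have "(\<Sum>i\<le>J. card (set (layer J i))) = 6 + (\<Sum>i<J. 21)"
    unfolding sum.atMost_shift by (simp add: card_layer)
  finally show ?thesis
    by simp
qed

text \<open>Vertices on the lower boundary of a layer are counted with the layer below.\<close>

definition new_verts :: "nat \<Rightarrow> nat \<Rightarrow> point set" where
  "new_verts J i = {v \<in> verts (set (layer J i)). 16 * int i - 12 < snd v}"

lemma verts_set: "verts (set Q) = set (map node (concat Q))"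
  unfolding verts_def by auto

lemma verts_layer_bounds:
  assumes "i \<le> Suc J" "v \<in> verts (set (layer J i))"
  shows "16 * int i - 12 \<le> snd v" "snd v \<le> 16 * int i + 4"
proof -
  obtain q u where "q \<in> set (layer J i)" "u \<in> set q" "v = node u"
    using assms(2) unfolding verts_def by blast
  then show "16 * int i - 12 \<le> snd v" "snd v \<le> 16 * int i + 4"
    using layer_confined[OF assms(1)] unfolding confined_def by (simp_all add: node_def)
qed

text \<open>By \<open>shared_blocks\<close>, a vertex on the lower boundary of a layer lies on the
  upper boundary of the layer underneath and is counted there.\<close>

lemma verts_wheels: "verts (set (wheels J)) = (\<Union>i\<le>Suc J. new_verts J i)"
proof
  show "(\<Union>i\<le>Suc J. new_verts J i) \<subseteq> verts (set (wheels J))"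
    unfolding new_verts_def verts_def set_wheels by blast
  show "verts (set (wheels J)) \<subseteq> (\<Union>i\<le>Suc J. new_verts J i)"
  proof
    fix v assume "v \<in> verts (set (wheels J))"
    then obtain i where i: "i \<le> Suc J" "v \<in> verts (set (layer J i))"
      unfolding verts_def set_wheels by blast
    show "v \<in> (\<Union>i\<le>Suc J. new_verts J i)"
    proof (cases "16 * int i - 12 < snd v")
      case True
      then show ?thesis using i unfolding new_verts_def by blast
    next
      case False
      then have v: "snd v = 16 * int i - 12"
        using verts_layer_bounds[OF i] by simp
      \<comment> \<open>Layer 0 has no vertex at its formal lower boundary -12.\<close>
      have "i \<noteq> 0"
      proof
        assume "i = 0"
        then have "v \<in> set (map node (concat bottom))"
          using i(2) unfolding layer_def verts_set by simp
        from bspec[OF bottom_above this] show False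
          using v \<open>i = 0\<close> by simp
      qed
      then obtain j where j: "i = Suc j"
        using not0_implies_Suc by blast
      define Q where "Q = (if i \<le> J then period else top_cap)"
      have "layer J i = map (map (lift (int j))) Q"
      proof (cases "i \<le> J")
        case False
        then have "J = j"
          using i(1) j by simp
        then show ?thesis
          using j unfolding layer_def Q_def by simp
      qed (use j in \<open>simp add: layer_def Q_def\<close>)
      then obtain w where w: "v = lift (int j) w" "w \<in> verts (set Q)"
        using i(2) verts_lift[of "int j" "set Q"] by auto
      then have "snd w \<le> 4"
        using v j by simp
      then have sh: "w \<in> verts (set bottom)" "lift 1 w \<in> verts (set period)"
        using shared_blocks w(2) unfolding shared_def Q_def verts_set by (auto split: if_splits)
      have "v \<in> verts (set (layer J j))"
      proof (cases j)
        case 0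
        then show ?thesis using sh(1) w(1) by (simp add: layer_def lift_0)
      next
        case (Suc l)
        then have "layer J j = map (map (lift (int l))) period"
          using i(1) j unfolding layer_def by simp
        moreover have "v = lift (int l) (lift 1 w)"
          using w(1) Suc by (simp add: lift_lift add.commute)
        ultimately show ?thesis
          using sh(2) verts_lift[of "int l" "set period"] by auto
      qed
      then have "v \<in> new_verts J j"
        using v j unfolding new_verts_def by simp
      then show ?thesis
        using i(1) j by auto
    qed
  qed
qed

lemma card_new_verts:
  assumes "i \<le> Suc J"
  shows "card (new_verts J i) = (if i = 0 then 24 else if i \<le> J then 72 else 26)"
proof -
  have lift: "card {v \<in> verts (map (lift k) ` set Q). 16 * k + 4 < snd v} = length (fresh Q)" for k Q
  proof -
    have "{v \<in> verts (map (lift k) ` set Q). 16 * k + 4 < snd v} = lift k ` {v \<in> verts (set Q). 4 < snd v}"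
      unfolding verts_lift by auto
    then have "card {v \<in> verts (map (lift k) ` set Q). 16 * k + 4 < snd v} = card {v \<in> verts (set Q). 4 < snd v}"
      using card_image[OF inj_on_subset[OF inj_lift subset_UNIV]] by metis
    also have "{v \<in> verts (set Q). 4 < snd v} = set (fresh Q)"
      unfolding verts_set fresh_def by auto
    also have "card (set (fresh Q)) = length (fresh Q)"
      by (rule distinct_card) (simp add: fresh_def)
    finally show ?thesis .
  qed
  consider "i = 0" | "0 < i" "i \<le> J" | "i = Suc J"
    using assms by linarith
  then show ?thesis
  proof cases
    case 1
    have "new_verts J 0 = set (remdups (map node (concat bottom)))"
      using bottom_above unfolding new_verts_def layer_def by (auto simp: verts_set)
    then show ?thesis
      using 1 fresh_length by (simp add: distinct_card del: set_remdups)
  next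
    case 2
    then show ?thesis
      using lift[of "int i - 1" period] fresh_length
      unfolding new_verts_def layer_def by (simp add: algebra_simps)
  next
    case 3
    then show ?thesis
      using lift[of "int J" top_cap] fresh_length
      unfolding new_verts_def layer_def by (simp add: algebra_simps)
  qed
qed

text \<open>New vertices of different layers lie in disjoint half-open strips; bottom and cap give
  \<open>24 + 26 = 50\<close>.\<close>

lemma card_verts_wheels: "card (verts (set (wheels J))) = 50 + 72 * J"
proof -
  have "new_verts J i \<inter> new_verts J j = {}" if "i \<le> Suc J" "j \<le> Suc J" "i \<noteq> j" for i j
  proof -
    have "i = j" if "v \<in> new_verts J i" "v \<in> new_verts J j" for v
      using verts_layer_bounds(2)[OF \<open>i \<le> Suc J\<close>] verts_layer_bounds(2)[OF \<open>j \<le> Suc J\<close>] that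
      unfolding new_verts_def by fastforce
    then show ?thesis
      using \<open>i \<noteq> j\<close> by blast
  qed
  moreover have "finite (new_verts J i)" for i
    unfolding new_verts_def verts_set by simp
  ultimately have "card (verts (set (wheels J))) = (\<Sum>i\<le>Suc J. card (new_verts J i))"
    unfolding verts_wheels by (intro card_UN_disjoint) auto
  also have "\<dots> = (\<Sum>i\<le>J. card (new_verts J i)) + 26"
    by (simp add: card_new_verts)
  also have "(\<Sum>i\<le>J. card (new_verts J i)) = 24 + (\<Sum>i<J. 72)"
    unfolding sum.atMost_shift by (simp add: card_new_verts)
  finally show ?thesis
    by simp
qed

section \<open>Excluding short cycles\<close>

text \<open>The lexicographic order: it lets the search start at the least vertex of a cycle or
  clique, and it directs the search tree.\<close>

definition prec :: "point \<Rightarrow> point \<Rightarrow> bool" where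
  "prec p q = (if fst p = fst q then snd p < snd q else fst p < fst q)"

text \<open>A binary search tree from vertices to neighbour lists, to keep lookup cheap during
  evaluation.\<close>

datatype adjacency = Leaf | Node adjacency point "point list" adjacency

fun nbrs :: "adjacency \<Rightarrow> point \<Rightarrow> point list" where
  "nbrs Leaf v = []"
| "nbrs (Node l w ns r) v = (if v = w then ns else if prec v w then nbrs l v else nbrs r v)"

fun add_nbr :: "adjacency \<Rightarrow> point \<Rightarrow> point \<Rightarrow> adjacency" where
  "add_nbr Leaf v x = Node Leaf v [x] Leaf"
| "add_nbr (Node l w ns r) v x =
     (if v = w then Node l w (x # ns) r
      else if prec v w then Node (add_nbr l v x) w ns r else Node l w ns (add_nbr r v x))"

fun adjacency_of :: "(point \<times> point) list \<Rightarrow> adjacency" where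
  "adjacency_of [] = Leaf"
| "adjacency_of (e # es) = add_nbr (adjacency_of es) (fst e) (snd e)"

fun keys :: "adjacency \<Rightarrow> point list" where
  "keys Leaf = []"
| "keys (Node l w ns r) = keys l @ w # keys r"

definition links :: "point list list \<Rightarrow> (point \<times> point) list" where
  "links Q = concat (map (\<lambda>s. [(node (fst s), node (snd s)), (node (snd s), node (fst s))])
     (concat (map segments Q)))"

text \<open>Paths are stored in reverse and without their start \<open>a\<close>, which precedes all their vertices.\<close>

fun extend :: "adjacency \<Rightarrow> point \<Rightarrow> point list list \<Rightarrow> point list list" where
  "extend t a [] = []"
| "extend t a (p # ps) =
     map (\<lambda>x. x # p) (filter (\<lambda>x. prec a x \<and> x \<notin> set p) (nbrs t (hd p))) @ extend t a ps"

definition paths :: "adjacency \<Rightarrow> point \<Rightarrow> point list list" where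
  "paths t a = extend t a (extend t a (map (\<lambda>b. [b]) (filter (prec a) (nbrs t a))))"

text \<open>A hexagon with first vertex \<open>a\<close> consists of two paths of length 3 from \<open>a\<close> with the same end and
  disjoint interiors.\<close>

definition meets :: "point list \<Rightarrow> point list \<Rightarrow> bool" where
  "meets p q = (if hd p = hd q then \<exists>x\<in>set (tl p). x \<in> set (tl q) else True)"

text \<open>A \<open>K\<^sub>4\<close> with first vertex \<open>a\<close> shows up as two paths \<open>a b c d\<close> and \<open>a c b d\<close> whose end is
  adjacent to \<open>a\<close>.\<close>

definition clique_free :: "point list \<Rightarrow> point list list \<Rightarrow> bool" where
  "clique_free A ps \<longleftrightarrow> (\<forall>p\<in>set (filter (\<lambda>p. hd p \<in> set A) ps). hd p # rev (tl p) \<notin> set ps)"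

text \<open>\<open>sorted_wrt\<close> compares each pair of positions once, which suffices because
  \<open>meets\<close> is symmetric.\<close>

definition checked_from :: "adjacency \<Rightarrow> point \<Rightarrow> point list list \<Rightarrow> bool" where
  "checked_from t a ps \<longleftrightarrow> sorted_wrt meets ps \<and> clique_free (nbrs t a) ps"

definition checked :: "adjacency \<Rightarrow> bool" where
  "checked t \<longleftrightarrow> (\<forall>a\<in>set (keys t). checked_from t a (paths t a))"

lemma checked_0: "checked (adjacency_of (links (wheels 0)))"
  by code_simp

lemma checked_2: "checked (adjacency_of (links (wheels 2)))"
  by code_simp

section \<open>Correctness of the search\<close>

lemma prec_least:
  assumes "finite A" "A \<noteq> {}"
  shows "\<exists>a\<in>A. \<forall>x\<in>A. x \<noteq> a \<longrightarrow> prec a x"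
proof -
  define B where "B = {p \<in> A. fst p = Min (fst ` A)}"
  have "Min (fst ` A) \<in> fst ` A"
    using assms by simp
  then obtain p where "p \<in> A" "fst p = Min (fst ` A)"
    by (metis imageE)
  then have "B \<noteq> {}" and "finite B"
    using assms(1) unfolding B_def by (blast, simp)
  then have "Min (snd ` B) \<in> snd ` B"
    by simp
  then obtain a where a: "a \<in> B" "snd a = Min (snd ` B)"
    by (metis imageE)
  have "prec a x" if x: "x \<in> A" "x \<noteq> a" for x
  proof (cases "fst x = fst a")
    case True
    then have "x \<in> B"
      using x a unfolding B_def by simp
    then have "snd a \<le> snd x"
      using a(2) \<open>finite B\<close> by simp
    moreover have "snd x \<noteq> snd a"
      using True x(2) by (simp add: prod_eq_iff)
    ultimately show ?thesis
      using True unfolding prec_def by simp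
  next
    case False
    have "fst a \<le> fst x"
      using a(1) x(1) assms(1) unfolding B_def by simp
    then show ?thesis
      using False unfolding prec_def by simp
  qed
  then show ?thesis
    using a(1) unfolding B_def by blast
qed

text \<open>Insertion and lookup of a vertex descend by the same comparisons.\<close>

lemma set_nbrs_add_nbr:
  "set (nbrs (add_nbr t v x) w) = (if w = v then insert x (set (nbrs t w)) else set (nbrs t w))"
  by (induction t) auto

lemma set_nbrs_adjacency_of: "set (nbrs (adjacency_of es) v) = {x. (v, x) \<in> set es}"
proof (induction es)
  case (Cons e es)
  obtain a b where "e = (a, b)"
    by (cases e)
  then show ?case
    using Cons by (cases "v = a") (simp_all add: set_nbrs_add_nbr, blast)
qed simp

lemma nbrs_keys: "x \<in> set (nbrs t v) \<Longrightarrow> v \<in> set (keys t)"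
  by (induction t) (auto split: if_splits)

lemma in_set_concat_map: "x \<in> set xs \<Longrightarrow> y \<in> set (f x) \<Longrightarrow> y \<in> set (concat (map f xs))"
  by auto

lemma edge_nbrs:
  assumes "{u, v} \<in> edges (set Q)"
  shows "v \<in> set (nbrs (adjacency_of (links Q)) u)"
proof -
  obtain q a b where q: "q \<in> set Q" "(a, b) \<in> set (segments q)" "{u, v} = {node a, node b}"
    using assms unfolding edges_def segs_def edge_def by fastforce
  have "(a, b) \<in> set (concat (map segments Q))"
    using q(1,2) by (rule in_set_concat_map)
  then have "(node a, node b) \<in> set (links Q)" "(node b, node a) \<in> set (links Q)"
    unfolding links_def by (rule in_set_concat_map; simp)+
  then show ?thesis
    using q(3) unfolding set_nbrs_adjacency_of doubleton_eq_iff by blast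
qed

lemma set_extend: "set (extend t a ps) =
    (\<Union>p\<in>set ps. (\<lambda>x. x # p) ` {x \<in> set (nbrs t (hd p)). prec a x \<and> x \<notin> set p})"
  by (induction ps) simp_all

lemma extendI:
  assumes "p \<in> set ps" "x \<in> set (nbrs t (hd p))" "prec a x" "x \<notin> set p"
  shows "x # p \<in> set (extend t a ps)"
  using assms unfolding set_extend by blast

lemma pathsI:
  assumes "b \<in> set (nbrs t a)" "c \<in> set (nbrs t b)" "d \<in> set (nbrs t c)"
    and "prec a b" "prec a c" "prec a d" and "c \<noteq> b" "d \<noteq> c" "d \<noteq> b"
  shows "[d, c, b] \<in> set (paths t a)"
proof -
  have "[b] \<in> set (map (\<lambda>b. [b]) (filter (prec a) (nbrs t a)))"
    using assms by simp
  then have "[c, b] \<in> set (extend t a (map (\<lambda>b. [b]) (filter (prec a) (nbrs t a))))"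
    by (rule extendI) (use assms in simp_all)
  then show ?thesis
    unfolding paths_def by (rule extendI) (use assms in simp_all)
qed

lemma sorted_wrt_cases:
  assumes "sorted_wrt P xs" "x \<in> set xs" "y \<in> set xs" "x \<noteq> y"
  shows "P x y \<or> P y x"
  using assms by (induction xs) auto

text \<open>Rotated so that its least vertex \<open>a\<close> comes first, a hexagon splits into the
  paths \<open>a b c d\<close> and \<open>a f e d\<close>. Their interiors are disjoint,
  contradicting \<open>meets\<close>.\<close>

lemma checked_not_C6:
  assumes t: "checked t" and E: "\<And>u v. {u, v} \<in> E \<Longrightarrow> v \<in> set (nbrs t u)"
  shows "\<not> contains_C6 V E"
proof
  define hex where "hex a b c d e f \<longleftrightarrow> distinct [a, b, c, d, e, f] \<and> {a, b} \<in> E \<and> {b, c} \<in> E \<and>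
      {c, d} \<in> E \<and> {d, e} \<in> E \<and> {e, f} \<in> E \<and> {f, a} \<in> E" for a b c d e f
  have no: False if h: "hex a b c d e f" and min: "\<forall>x\<in>{b, c, d, e, f}. prec a x" for a b c d e f
  proof -
    have "b \<in> set (nbrs t a)" "c \<in> set (nbrs t b)" "d \<in> set (nbrs t c)"
      "f \<in> set (nbrs t a)" "e \<in> set (nbrs t f)" "d \<in> set (nbrs t e)"
      using h E unfolding hex_def by (simp_all add: insert_commute)
    then have p: "[d, c, b] \<in> set (paths t a)" "[d, e, f] \<in> set (paths t a)" and "a \<in> set (keys t)"
      using h min nbrs_keys unfolding hex_def by (auto intro!: pathsI)
    then have "sorted_wrt meets (paths t a)"
      using t unfolding checked_def checked_from_def by blast
    from sorted_wrt_cases[OF this p] show False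
      using h unfolding meets_def hex_def by auto
  qed
  assume "contains_C6 V E"
  then obtain v :: "nat \<Rightarrow> point" where v: "inj_on v {..<6}" "\<forall>i<6. {v i, v ((i + 1) mod 6)} \<in> E"
    unfolding contains_C6_def by blast
  have "inj_on v {0, 1, 2, 3, 4, 5}"
    by (rule inj_on_subset[OF v(1)]) simp
  then have dist: "distinct [v 0, v 1, v 2, v 3, v 4, v 5]"
    using distinct_map[of v "[0, 1, 2, 3, 4, 5]"] by simp
  have "{v 1, v 2} \<in> E"
    using v(2)[rule_format, of 1] by (simp add: numeral_2_eq_2)
  then have h: "hex (v 0) (v 1) (v 2) (v 3) (v 4) (v 5)"
    using dist v(2)[rule_format, of 0] v(2)[rule_format, of 2]
      v(2)[rule_format, of 3] v(2)[rule_format, of 4] v(2)[rule_format, of 5]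
    unfolding hex_def by simp
  have rot: "hex b c d e f a" if "hex a b c d e f" for a b c d e f
    using that unfolding hex_def by auto
  let ?A = "{v 0, v 1, v 2, v 3, v 4, v 5}"
  obtain a where a: "a \<in> ?A" "\<forall>x\<in>?A. x \<noteq> a \<longrightarrow> prec a x"
    using prec_least[of ?A] by blast
  note h1 = rot[OF h] note h2 = rot[OF h1] note h3 = rot[OF h2] note h4 = rot[OF h3] note h5 = rot[OF h4]
  from a(1) consider "a = v 0" | "a = v 1" | "a = v 2" | "a = v 3" | "a = v 4" | "a = v 5"
    by blast
  then show False
  proof cases
    case 1 show False by (rule no[OF h]) (use a(2) dist 1 in auto)
  next
    case 2 show False by (rule no[OF h1]) (use a(2) dist 2 in auto)
  next
    case 3 show False by (rule no[OF h2]) (use a(2) dist 3 in auto)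
  next
    case 4 show False by (rule no[OF h3]) (use a(2) dist 4 in auto)
  next
    case 5 show False by (rule no[OF h4]) (use a(2) dist 5 in auto)
  next
    case 6 show False by (rule no[OF h5]) (use a(2) dist 6 in auto)
  qed
qed

text \<open>From the least vertex \<open>x\<close>, the other three give the paths
  \<open>x p q r\<close> and \<open>x q p r\<close> with \<open>r\<close> adjacent to
  \<open>x\<close>, which \<open>clique_free\<close> forbids.\<close>

lemma checked_not_K4:
  assumes t: "checked t" and E: "\<And>u v. {u, v} \<in> E \<Longrightarrow> v \<in> set (nbrs t u)"
  shows "\<not> contains_K4 V E"
proof
  assume "contains_K4 V E"
  then obtain a b c d where dist: "distinct [a, b, c, d]"
    and e: "{a, b} \<in> E" "{a, c} \<in> E" "{a, d} \<in> E" "{b, c} \<in> E" "{b, d} \<in> E" "{c, d} \<in> E"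
    unfolding contains_K4_def by blast
  have e': "{b, a} \<in> E" "{c, a} \<in> E" "{d, a} \<in> E" "{c, b} \<in> E" "{d, b} \<in> E" "{d, c} \<in> E"
    using e by (simp_all add: insert_commute)
  define A where "A = {a, b, c, d}"
  have adj: "v \<in> set (nbrs t u)" if "u \<in> A" "v \<in> A" "u \<noteq> v" for u v
    using that e e' E unfolding A_def
    by (elim insertE emptyE) simp_all
  obtain x where x: "x \<in> A" "\<forall>y\<in>A. y \<noteq> x \<longrightarrow> prec x y"
    using prec_least[of A] unfolding A_def by blast
  have "card (A - {x}) = 3"
    using dist x(1) unfolding A_def by auto
  then obtain p q r where pqr: "A - {x} = {p, q, r}" "p \<noteq> q" "p \<noteq> r" "q \<noteq> r"
    by (auto simp: card_3_iff)
  then have mem: "p \<in> A" "q \<in> A" "r \<in> A" "p \<noteq> x" "q \<noteq> x" "r \<noteq> x"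
    by blast+
  then have "[r, q, p] \<in> set (paths t x)"
    using adj x pqr by (intro pathsI) auto
  moreover have "[r, p, q] \<in> set (paths t x)"
    using adj x pqr mem by (intro pathsI) auto
  moreover have "r \<in> set (nbrs t x)" "x \<in> set (keys t)"
    using adj[OF x(1) mem(3)] mem(6) nbrs_keys by blast+
  moreover from this have "clique_free (nbrs t x) (paths t x)"
    using t unfolding checked_def checked_from_def by blast
  ultimately show False
    unfolding clique_free_def by force
qed

lemma base_free:
  assumes "K \<in> {0, 2}"
  shows "\<not> contains_C6 V (edges (set (wheels K)))" "\<not> contains_K4 V (edges (set (wheels K)))"
proof -
  have t: "checked (adjacency_of (links (wheels K)))"
    using assms checked_0 checked_2 by blast
  show "\<not> contains_C6 V (edges (set (wheels K)))"
    by (rule checked_not_C6[OF t edge_nbrs])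
  show "\<not> contains_K4 V (edges (set (wheels K)))"
    by (rule checked_not_K4[OF t edge_nbrs])
qed

section \<open>From the two evaluated graphs to every height\<close>

lemma edges_UN: "edges (\<Union>i\<in>I. S i) = (\<Union>i\<in>I. edges (S i))"
  unfolding edges_def segs_def by blast

lemma edges_mono: "S \<subseteq> T \<Longrightarrow> edges S \<subseteq> edges T"
  unfolding edges_def segs_def by (intro image_mono UN_mono) auto

lemma edge_verts:
  assumes "e \<in> edges S"
  shows "e \<subseteq> verts S"
proof -
  obtain q a b where q: "q \<in> S" "(a, b) \<in> set (segments q)" "e = {node a, node b}"
    using assms unfolding edges_def segs_def edge_def by fastforce
  then show ?thesis
    using segments_endpoints(1,2)[OF q(2)] unfolding verts_def by blast
qed

lemma edge_height:
  assumes "{u, v} \<in> edges (set (wheels J))"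
  shows "snd u \<le> snd v + 4"
proof -
  obtain i where i: "i \<le> Suc J" "{u, v} \<in> edges (set (layer J i))"
    using assms unfolding set_wheels edges_UN by blast
  then obtain q a b where q: "q \<in> set (layer J i)" "(a, b) \<in> set (segments q)" "{u, v} = {node a, node b}"
    unfolding edges_def segs_def edge_def by fastforce
  then have "\<bar>snd a - snd b\<bar> \<le> 4"
    using layer_confined[OF i(1)] unfolding confined_def by fastforce
  moreover have "u = node a \<and> v = node b \<or> u = node b \<and> v = node a"
    using q(3) unfolding doubleton_eq_iff .
  ultimately show ?thesis
    by (elim disjE conjE) (simp_all add: node_def)
qed

text \<open>A subgraph of height at most 12 meets only the lowest layer in which it has an edge and
  the next one, and such a window is a translate of a part of \<open>wheels 0\<close> or
  \<open>wheels 2\<close>.\<close>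

lemma edges_window:
  assumes F: "F \<subseteq> edges (set (wheels J))" "F \<noteq> {}"
    and close: "\<And>u v. u \<in> \<Union>F \<Longrightarrow> v \<in> \<Union>F \<Longrightarrow> snd u \<le> snd v + 12"
  shows "\<exists>K\<in>{0, 2}. \<exists>k. \<forall>e\<in>F. lift k ` e \<in> edges (set (wheels K))"
proof -
  define I where "I = {i. i \<le> Suc J \<and> F \<inter> edges (set (layer J i)) \<noteq> {}}"
  have layers: "\<exists>i\<in>I. e \<in> edges (set (layer J i))" if "e \<in> F" for e
    using F(1) that unfolding set_wheels edges_UN I_def by blast
  then have I: "finite I" "I \<noteq> {}"
    using F(2) unfolding I_def by auto
  define i where "i = Min I"
  have "i \<in> I"
    unfolding i_def using I by (rule Min_in)
  then obtain e0 where e0: "i \<le> Suc J" "e0 \<in> F" "e0 \<in> edges (set (layer J i))"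
    unfolding I_def by blast
  have nonempty: "e \<noteq> {}" if "e \<in> edges S" for e S
    using that unfolding edges_def edge_def by blast
  have near: "e \<in> edges (set (layer J (min i J)) \<union> set (layer J (Suc (min i J))))" if e: "e \<in> F" for e
  proof -
    obtain j where j: "j \<in> I" "e \<in> edges (set (layer J j))"
      using layers[OF e] by blast
    then have "i \<le> j" "j \<le> Suc J"
      using I(1) unfolding i_def I_def by simp_all
    obtain u v where u: "u \<in> e0" and v: "v \<in> e"
      using nonempty e0(3) j(2) by blast
    then have "snd v \<le> snd u + 12"
      using close e e0(2) by blast
    moreover have "snd u \<le> 16 * int i + 4"
      using verts_layer_bounds(2)[OF e0(1)] edge_verts[OF e0(3)] u by blast
    moreover have "16 * int j - 12 \<le> snd v"
      using verts_layer_bounds(1)[OF \<open>j \<le> Suc J\<close>] edge_verts[OF j(2)] v by blast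
    \<comment> \<open>The three bounds give \<open>16 * (j - i) \<le> 28\<close>.\<close>
    ultimately have "j \<le> Suc i"
      by linarith
    then have "j = min i J \<or> j = Suc (min i J)"
      using \<open>i \<le> j\<close> \<open>j \<le> Suc J\<close> by linarith
    then have "set (layer J j) \<subseteq> set (layer J (min i J)) \<union> set (layer J (Suc (min i J)))"
      by blast
    from edges_mono[OF this] show ?thesis
      using j(2) by blast
  qed
  obtain K k where K: "K \<in> {0, 2}"
    and sub: "set (layer J (min i J)) \<union> set (layer J (Suc (min i J))) \<subseteq> map (lift k) ` set (wheels K)"
    using layer_window[OF min.cobounded2] by blast
  have "lift (- k) ` e \<in> edges (set (wheels K))" if "e \<in> F" for e
  proof -
    have "e \<in> edges (map (lift k) ` set (wheels K))"
      using near[OF that] edges_mono[OF sub] by blast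
    then obtain e' where "e' \<in> edges (set (wheels K))" "e = lift k ` e'"
      unfolding edges_lift by blast
    then show ?thesis
      by (simp add: image_comp lift_comp lift_0)
  qed
  then show ?thesis
    using K by blast
qed

lemma wheels_not_C6: "\<not> contains_C6 V (edges (set (wheels J)))"
proof
  assume "contains_C6 V (edges (set (wheels J)))"
  then obtain v :: "nat \<Rightarrow> point" where inj: "inj_on v {..<6}"
    and E: "\<And>i. i < 6 \<Longrightarrow> {v i, v ((i + 1) mod 6)} \<in> edges (set (wheels J))"
    unfolding contains_C6_def by blast
  define F where "F = (\<lambda>i. {v i, v ((i + 1) mod 6)}) ` {..<6}"
  have step: "snd (v i) \<le> snd (v ((i + 1) mod 6)) + 4" "snd (v ((i + 1) mod 6)) \<le> snd (v i) + 4"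
    if "i < 6" for i
    using edge_height E[OF that] by (blast, metis insert_commute)
  have steps: "snd (v i) \<le> snd (v (Suc i)) + 4" "snd (v (Suc i)) \<le> snd (v i) + 4" if "i < 5" for i
    using step[of i] that by simp_all
  have ends: "snd (v 5) \<le> snd (v 0) + 4" "snd (v 0) \<le> snd (v 5) + 4"
    using step[of 5] by simp_all
  \<comment> \<open>Two vertices of a hexagon are at most three edges apart, each rising by at most
    4.\<close>
  have close: "snd (v i) \<le> snd (v j) + 12" if "i < 6" "j < 6" for i j
  proof -
    have six: "m = 0 \<or> m = 1 \<or> m = 2 \<or> m = 3 \<or> m = 4 \<or> m = 5" if "m < 6" for m :: nat
      using that by linarith
    show ?thesis
      using six[OF \<open>i < 6\<close>] six[OF \<open>j < 6\<close>] steps[of 0] steps[of 1] steps[of 2] steps[of 3] steps[of 4] ends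
      by (simp add: numeral_eq_Suc) (elim disjE; simp)
  qed
  have UF: "\<Union>F \<subseteq> v ` {..<6}"
    unfolding F_def by auto
  have "F \<subseteq> edges (set (wheels J))" "F \<noteq> {}"
    using E unfolding F_def by (auto simp: lessThan_empty_iff)
  then obtain K k where K: "K \<in> {0, 2}" "\<forall>e\<in>F. lift k ` e \<in> edges (set (wheels K))"
    using edges_window[of F J] close UF by (smt (verit) image_iff lessThan_iff subset_iff)
  have "contains_C6 UNIV F"
    unfolding contains_C6_def F_def using inj by (intro exI[of _ v]) auto
  then have "contains_C6 UNIV (edges (set (wheels K)))"
    by (rule contains_C6_map[OF _ inj_lift]) (use K(2) in auto)
  then show False
    using base_free(1)[OF K(1)] by blast
qed

lemma wheels_not_K4: "\<not> contains_K4 V (edges (set (wheels J)))"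
proof
  assume "contains_K4 V (edges (set (wheels J)))"
  then obtain a b c d where dist: "distinct [a, b, c, d]"
    and e: "{a, b} \<in> edges (set (wheels J))" "{a, c} \<in> edges (set (wheels J))"
      "{a, d} \<in> edges (set (wheels J))" "{b, c} \<in> edges (set (wheels J))"
      "{b, d} \<in> edges (set (wheels J))" "{c, d} \<in> edges (set (wheels J))"
    unfolding contains_K4_def by blast
  define F where "F = {{a, b}, {a, c}, {a, d}, {b, c}, {b, d}, {c, d}}"
  have e': "{b, a} \<in> edges (set (wheels J))" "{c, a} \<in> edges (set (wheels J))"
      "{d, a} \<in> edges (set (wheels J))" "{c, b} \<in> edges (set (wheels J))"
      "{d, b} \<in> edges (set (wheels J))" "{d, c} \<in> edges (set (wheels J))"
    using e by (simp_all add: insert_commute)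
  note h = e[THEN edge_height] e'[THEN edge_height]
  have "snd u \<le> snd v + 12" if "u \<in> \<Union>F" "v \<in> \<Union>F" for u v
  proof -
    have "u \<in> {a, b, c, d}" "v \<in> {a, b, c, d}"
      using that unfolding F_def by blast+
    then show ?thesis
      using h by (elim insertE emptyE) simp_all
  qed
  moreover have "F \<subseteq> edges (set (wheels J))" "F \<noteq> {}"
    using e unfolding F_def by simp_all
  ultimately obtain K k where K: "K \<in> {0, 2}" "\<forall>e\<in>F. lift k ` e \<in> edges (set (wheels K))"
    using edges_window[of F J] by blast
  have "contains_K4 UNIV F"
    unfolding contains_K4_def F_def using dist by (intro exI[of _ a] exI[of _ b] exI[of _ c] exI[of _ d]) simp
  then have "contains_K4 UNIV (edges (set (wheels K)))"
    by (rule contains_K4_map[OF _ inj_lift]) (use K(2) in auto)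
  then show False
    using base_free(2)[OF K(1)] by blast
qed

section \<open>Choice of the number of periods and comparison of the counts\<close>

theorem theorem4:
  fixes n :: nat
  assumes "n > 0" and "n mod 288 = 50"
  shows "\<exists>E :: nat set set. simple_graph {..<n} E \<and> planar {..<n} E \<and>
           \<not> contains_K4 {..<n} E \<and> \<not> contains_C6 {..<n} E \<and>
           real (card E) = 7 / 3 * (real n - 2)"
proof -
  \<comment> \<open>Each period adds 72 vertices and \<open>288 = 4 * 72\<close>.\<close>
  define J where "J = 4 * (n div 288)"
  have n: "n = 50 + 72 * J"
    using div_mult_mod_eq[of n 288] assms(2) unfolding J_def by linarith
  define S where "S = set (wheels J)"
  have S: "finite S" "drawn S"
    unfolding S_def using drawn_wheels by simp_all
  have "card (verts S) = n"
    unfolding S_def n by (rule card_verts_wheels)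
  from graph_on_initial_segment[OF this simple_graph_drawn[OF S] planar_drawn[OF S(2)]]
  obtain E :: "nat set set" where "simple_graph {..<n} E" "planar {..<n} E" "\<not> contains_K4 {..<n} E"
      "\<not> contains_C6 {..<n} E" and card: "card E = card (edges S)"
    using wheels_not_K4 wheels_not_C6 unfolding S_def by blast
  \<comment> \<open>This is \<open>8 * (14 + 21 * J)\<close>, which is 7/3 of
    \<open>n - 2 = 48 + 72 * J\<close>.\<close>
  moreover have "card E = 112 + 168 * J"
    unfolding card card_edges_drawn[OF S] unfolding S_def card_wheels by simp
  then have "real (card E) = 7 / 3 * (real n - 2)"
    unfolding n by simp
  ultimately show ?thesis
    by blast
qed

end
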